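(* Let $m\ge1$ be an integer and let $1 \leq p_{1}, \ldots , p_{m} \leq \infty$ be such that $\frac{1}{p_{1}} + \cdots + \frac{1}{p_{m}} < 1$. Consider the exponents \[ \frac{1}{\lambda} = 1 - \Big(\frac{1}{p_{1}} + \cdots + \frac{1}{p_{m}} \Big) \qquad \text{ and } \qquad \frac{1}{\mu} = \frac{1}{m \lambda} + \frac{m-1}{2m} . \] Then there exists $C>0$ such that, for every continuous $m$-linear $T : \ell_{p_{1}} \times \cdots \times \ell_{p_{m}} \to \mathbb{C}$ with coefficients $a_{i_{1}, \ldots , i_{m}}=T(e_{i_1},\dots,e_{i_m})$, we have: (i) If $\frac{1}{2} \leq \frac{1}{p_{1}} + \cdots + \frac{1}{p_{m}} < 1$, then \[ \Big( \sum_{i_{1}, \ldots, i_{m}=1}^{\infty} \vert a_{i_{1}, \ldots , i_{m}} \vert^{\lambda}\Big)^{1/\lambda} \leq C \Vert T \Vert . \] (ii) If $0 \leq \frac{1}{p_{1}} + \cdots + \frac{1}{p_{m}} < \frac{1}{2}$, then \[ \Big( \sum_{i_{1}, \ldots, i_{m}=1}^{\infty} \vert a_{i_{1}, \ldots , i_{m}} \vert^{\mu}\Big)^{1/\mu} \leq C \Vert T \Vert . \] Moreover the exponents ($\lambda$ in case (i), $\mu$ in case (ii)) are optimal.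
   Context: All spaces are complex; $1/\infty=0$; $e_i$ is the $i$-th canonical unit vector. The norm is $\Vert T \Vert = \sup \{ \vert T(x_{1}, \ldots , x_{m}) \vert : \|x_j\|<1,\ j=1,\ldots,m\}$. An exponent is optimal (for given $m,p_1,\dots,p_m$) if it cannot be replaced by any smaller one: whenever $t$ is such that there is $C>0$ with $\big(\sum_{i_1,\dots,i_m}|a_{i_1,\dots,i_m}|^t\big)^{1/t}\le C\|T\|$ for every continuous $m$-linear $T : \ell_{p_{1}} \times \cdots \times \ell_{p_{m}} \to \mathbb{C}$, then $t\ge\lambda$ in case (i), respectively $t\ge\mu$ in case (ii). *)

theory Defs
  imports "HOL-Analysis.Analysis"
begin

text \<open>
  Sequences are indexed by \<open>nat\<close> starting at \<open>0\<close>, and the \<open>m\<close> factors by \<open>{..<m}\<close>.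
  Exponents live in \<^typ>\<open>ennreal\<close>, where \<open>1 / \<infinity> = 0\<close>.
\<close>

definition ell :: "ennreal \<Rightarrow> (nat \<Rightarrow> complex) set" where
  "ell p = (if p = \<infinity> then {x. bounded (range x)}
            else {x. summable (\<lambda>n. cmod (x n) powr enn2real p)})"

text \<open>
  Outside \<open>ell p\<close> the value is irrelevant; it is \<open>0\<close> because the locale
  \<^locale>\<open>Metric_space\<close> asks for a distance that is nonnegative on the whole type.
\<close>

definition ell_norm :: "ennreal \<Rightarrow> (nat \<Rightarrow> complex) \<Rightarrow> real" where
  "ell_norm p x = (if x \<notin> ell p then 0
                   else if p = \<infinity> then (SUP n. cmod (x n))
                   else (\<Sum>n. cmod (x n) powr enn2real p) powr (1 / enn2real p))"

definition ell_dist :: "ennreal \<Rightarrow> (nat \<Rightarrow> complex) \<Rightarrow> (nat \<Rightarrow> complex) \<Rightarrow> real" where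
  "ell_dist p x y = ell_norm p (\<lambda>n. x n - y n)"

definition ell_topology :: "ennreal \<Rightarrow> (nat \<Rightarrow> complex) topology" where
  "ell_topology p = Metric_space.mtopology (ell p) (ell_dist p)"

text \<open>
  A point of the product of the \<open>ell (p j)\<close>, \<open>j < m\<close>, is an extensional function on \<open>{..<m}\<close>,
  as in \<^const>\<open>product_topology\<close>. Values of \<open>T\<close> outside this set play no role.
\<close>

definition ell_prod :: "nat \<Rightarrow> (nat \<Rightarrow> ennreal) \<Rightarrow> (nat \<Rightarrow> nat \<Rightarrow> complex) set" where
  "ell_prod m p = (\<Pi>\<^sub>E j\<in>{..<m}. ell (p j))"

definition multilinear_form ::
    "nat \<Rightarrow> (nat \<Rightarrow> ennreal) \<Rightarrow> ((nat \<Rightarrow> nat \<Rightarrow> complex) \<Rightarrow> complex) \<Rightarrow> bool" where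
  "multilinear_form m p T \<longleftrightarrow>
     (\<forall>x\<in>ell_prod m p. \<forall>k<m. \<forall>u\<in>ell (p k). \<forall>v\<in>ell (p k). \<forall>a b.
        T (x(k := (\<lambda>n. a * u n + b * v n))) = a * T (x(k := u)) + b * T (x(k := v)))"

definition cont_multilinear_form ::
    "nat \<Rightarrow> (nat \<Rightarrow> ennreal) \<Rightarrow> ((nat \<Rightarrow> nat \<Rightarrow> complex) \<Rightarrow> complex) \<Rightarrow> bool" where
  "cont_multilinear_form m p T \<longleftrightarrow>
     multilinear_form m p T \<and>
     continuous_map (product_topology (\<lambda>j. ell_topology (p j)) {..<m}) euclidean T"

definition form_norm ::
    "nat \<Rightarrow> (nat \<Rightarrow> ennreal) \<Rightarrow> ((nat \<Rightarrow> nat \<Rightarrow> complex) \<Rightarrow> complex) \<Rightarrow> real" where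
  "form_norm m p T = (SUP x\<in>{x \<in> ell_prod m p. \<forall>j<m. ell_norm (p j) (x j) < 1}. cmod (T x))"

definition unit_seq :: "nat \<Rightarrow> nat \<Rightarrow> complex" where
  "unit_seq i = (\<lambda>n. if n = i then 1 else 0)"

definition form_coeff ::
    "nat \<Rightarrow> ((nat \<Rightarrow> nat \<Rightarrow> complex) \<Rightarrow> complex) \<Rightarrow> (nat \<Rightarrow> nat) \<Rightarrow> complex" where
  "form_coeff m T i = T (\<lambda>j\<in>{..<m}. unit_seq (i j))"

text \<open>
  \<open>coeff_bound m p t C\<close>: every continuous \<open>m\<close>-linear form satisfies the inequality between the
  \<open>t\<close>-sum of its coefficients and \<open>C\<close> times its norm. As \<^const>\<open>infsum\<close> is \<open>0\<close> on
  non-summable families, finiteness of the left-hand side is stated separately.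
\<close>

definition coeff_bound :: "nat \<Rightarrow> (nat \<Rightarrow> ennreal) \<Rightarrow> real \<Rightarrow> real \<Rightarrow> bool" where
  "coeff_bound m p t C \<longleftrightarrow>
     (\<forall>T. cont_multilinear_form m p T \<longrightarrow>
        (\<lambda>i. cmod (form_coeff m T i) powr t) summable_on (\<Pi>\<^sub>E j\<in>{..<m}. UNIV) \<and>
        (\<Sum>\<^sub>\<infinity>i\<in>(\<Pi>\<^sub>E j\<in>{..<m}. UNIV). cmod (form_coeff m T i) powr t) powr (1 / t)
          \<le> C * form_norm m p T)"


text \<open>The distance on \<open>ell p\<close> is a metric, so \<^const>\<open>ell_topology\<close> is its metric topology.\<close>

lemma powr_convex_comb:
  fixes r s t u v :: real
  assumes "r \<ge> 1" "s \<ge> 0" "t \<ge> 0" "u \<ge> 0" "v \<ge> 0" "u + v = 1"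
  shows "(u * s + v * t) powr r \<le> u * s powr r + v * t powr r"
proof -
  have z: "(w * q) powr r \<le> w * q powr r" if "0 \<le> w" "w \<le> 1" "0 \<le> q" for w q :: real
  proof (cases "w = 0")
    case False
    have "w powr r \<le> w powr 1"
      using that assms(1) False by (intro powr_mono') auto
    then show ?thesis
      using that False by (simp add: powr_mult mult_right_mono)
  qed simp
  show ?thesis
  proof (cases "s = 0 \<or> t = 0")
    case True
    then show ?thesis
      using z[of v t] z[of u s] assms by auto
  next
    case False
    then show ?thesis
      using convex_onD[OF powr_convex[OF assms(1)], of v s t] assms
      by (smt (verit, best) greaterThan_iff real_scaleR_def)
  qed
qed

lemma minkowski_aux:
  fixes r A B :: real and x y :: "nat \<Rightarrow> complex"
  assumes r: "r \<ge> 1" and A: "A > 0" and B: "B > 0"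
    and sx: "summable (\<lambda>n. cmod (x n) powr r)" and sy: "summable (\<lambda>n. cmod (y n) powr r)"
    and bx: "(\<Sum>n. cmod (x n) powr r) \<le> A powr r"
    and by': "(\<Sum>n. cmod (y n) powr r) \<le> B powr r"
  shows "summable (\<lambda>n. cmod (x n + y n) powr r)"
    and "(\<Sum>n. cmod (x n + y n) powr r) \<le> (A + B) powr r"
proof -
  define u v where "u = A / (A + B)" and "v = B / (A + B)"
  have uv: "u \<ge> 0" "v \<ge> 0" "u + v = 1"
    using A B by (auto simp: u_def v_def simp flip: add_divide_distrib)
  define h where "h n = (A + B) powr r *
    (u / A powr r * cmod (x n) powr r + v / B powr r * cmod (y n) powr r)" for n
  have le: "cmod (x n + y n) powr r \<le> h n" for n
  proof -
    have "cmod (x n + y n) \<le> (A + B) * (u * (cmod (x n) / A) + v * (cmod (y n) / B))"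
    proof -
      have "(A + B) * (u * (cmod (x n) / A) + v * (cmod (y n) / B)) = cmod (x n) + cmod (y n)"
        using A B by (simp add: u_def v_def distrib_left)
      then show ?thesis
        using norm_triangle_ineq[of "x n" "y n"] by simp
    qed
    then have "cmod (x n + y n) powr r
        \<le> ((A + B) * (u * (cmod (x n) / A) + v * (cmod (y n) / B))) powr r"
      using r by (intro powr_mono2) auto
    also have "\<dots> = (A + B) powr r * (u * (cmod (x n) / A) + v * (cmod (y n) / B)) powr r"
      by (rule powr_mult)
    also have "\<dots> \<le> (A + B) powr r *
        (u * (cmod (x n) / A) powr r + v * (cmod (y n) / B) powr r)"
      using A B uv r by (intro mult_left_mono powr_convex_comb) auto
    also have "\<dots> = h n"
      using A B by (simp add: h_def powr_divide)
    finally show ?thesis .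
  qed
  have sh: "summable h"
    unfolding h_def by (intro summable_mult summable_add sx sy)
  show s: "summable (\<lambda>n. cmod (x n + y n) powr r)"
    using le by (intro summable_comparison_test'[OF sh]) auto
  have "(\<Sum>n. cmod (x n + y n) powr r) \<le> suminf h"
    by (intro suminf_le le s sh)
  also have "suminf h = (A + B) powr r * (u / A powr r * (\<Sum>n. cmod (x n) powr r)
      + v / B powr r * (\<Sum>n. cmod (y n) powr r))"
    unfolding h_def
    by (simp only: suminf_mult suminf_add[symmetric] summable_mult summable_add sx sy)
  also have "\<dots> \<le> (A + B) powr r * (u / A powr r * A powr r + v / B powr r * B powr r)"
    using A B uv bx by' by (intro mult_left_mono add_mono) auto
  also have "\<dots> = (A + B) powr r"
    using A B uv by simp
  finally show "(\<Sum>n. cmod (x n + y n) powr r) \<le> (A + B) powr r" .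
qed

lemma ell_norm_nonneg: "ell_norm p x \<ge> 0"
proof (cases "x \<in> ell p \<and> p = \<infinity>")
  case True
  then have "bdd_above (range (\<lambda>n. cmod (x n)))"
    by (auto simp: ell_def bounded_iff bdd_above_def)
  then have "cmod (x 0) \<le> (SUP n. cmod (x n))"
    by (intro cSUP_upper) auto
  then show ?thesis
    using True order_trans[OF norm_ge_zero[of "x 0"]] by (simp add: ell_norm_def)
qed (auto simp: ell_norm_def)

lemma ell_minus:
  assumes "x \<in> ell p"
  shows "(\<lambda>n. - x n) \<in> ell p"
  using assms by (auto simp: ell_def bounded_iff)

lemma ell_norm_minus: "ell_norm p (\<lambda>n. - x n) = ell_norm p x"
  using ell_minus[of x p] ell_minus[of "\<lambda>n. - x n" p] by (auto simp: ell_norm_def)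

lemma ell_add_triangle:
  assumes p: "1 \<le> p" and x: "x \<in> ell p" and y: "y \<in> ell p"
  shows ell_add: "(\<lambda>n. x n + y n) \<in> ell p"
    and ell_norm_triangle: "ell_norm p (\<lambda>n. x n + y n) \<le> ell_norm p x + ell_norm p y"
proof -
  have "(\<lambda>n. x n + y n) \<in> ell p \<and> ell_norm p (\<lambda>n. x n + y n) \<le> ell_norm p x + ell_norm p y"
  proof (cases "p = \<infinity>")
    case True
    have bdd: "bdd_above (range (\<lambda>n. cmod (x n)))" "bdd_above (range (\<lambda>n. cmod (y n)))"
      using x y True by (auto simp: ell_def bounded_iff bdd_above_def)
    have le: "cmod (x n + y n) \<le> (SUP n. cmod (x n)) + (SUP n. cmod (y n))" for n
      using cSUP_upper[OF _ bdd(1), of n] cSUP_upper[OF _ bdd(2), of n]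
        norm_triangle_ineq[of "x n" "y n"] by simp
    then have "(\<lambda>n. x n + y n) \<in> ell p"
      using True by (auto simp: ell_def bounded_iff)
    moreover have "(SUP n. cmod (x n + y n)) \<le> (SUP n. cmod (x n)) + (SUP n. cmod (y n))"
      by (intro cSUP_least le) auto
    ultimately show ?thesis
      using x y True by (simp add: ell_norm_def)
  next
    case False
    define r where "r = enn2real p"
    have r: "r \<ge> 1"
      using p False enn2real_mono[of 1 p] by (simp add: r_def less_top)
    have sx: "summable (\<lambda>n. cmod (x n) powr r)" and sy: "summable (\<lambda>n. cmod (y n) powr r)"
      using x y False by (auto simp: ell_def r_def)
    have norm: "ell_norm p z = (\<Sum>n. cmod (z n) powr r) powr (1 / r)" if "z \<in> ell p" for z
      using that False by (simp add: ell_norm_def r_def)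
    have pw: "(\<Sum>n. cmod (z n) powr r) \<le> (ell_norm p z + e) powr r"
      if "z \<in> ell p" "e > 0" for z e
    proof -
      have "summable (\<lambda>n. cmod (z n) powr r)"
        using that False by (simp add: ell_def r_def)
      then have "(\<Sum>n. cmod (z n) powr r) \<ge> 0"
        by (intro suminf_nonneg) auto
      then have "(\<Sum>n. cmod (z n) powr r) = ell_norm p z powr r"
        using r that by (simp add: norm powr_powr)
      also have "\<dots> \<le> (ell_norm p z + e) powr r"
        using r that ell_norm_nonneg by (intro powr_mono2) auto
      finally show ?thesis .
    qed
    have pos: "ell_norm p z + e > 0" if "e > 0" for z e
      using ell_norm_nonneg[of p z] that by linarith
    have s: "summable (\<lambda>n. cmod (x n + y n) powr r)"
      by (rule minkowski_aux[OF r pos[of 1] pos[of 1] sx sy pw pw]) (use x y in auto)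
    then have mem: "(\<lambda>n. x n + y n) \<in> ell p"
      using False by (simp add: ell_def r_def)
    have "ell_norm p (\<lambda>n. x n + y n) \<le> ell_norm p x + ell_norm p y + d" if d: "d > 0" for d
    proof -
      have "(\<Sum>n. cmod (x n + y n) powr r)
          \<le> ((ell_norm p x + d / 2) + (ell_norm p y + d / 2)) powr r"
        by (rule minkowski_aux[OF r pos pos sx sy pw pw]) (use x y d in auto)
      then have "ell_norm p (\<lambda>n. x n + y n)
          \<le> (((ell_norm p x + d / 2) + (ell_norm p y + d / 2)) powr r) powr (1 / r)"
        unfolding norm[OF mem] using r s by (intro powr_mono2 suminf_nonneg) auto
      also have "\<dots> = ell_norm p x + ell_norm p y + d"
        using r pos[of "d / 2" x] pos[of "d / 2" y] d by (simp add: powr_powr)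
      finally show ?thesis .
    qed
    then show ?thesis
      using mem by (auto intro: field_le_epsilon)
  qed
  then show "(\<lambda>n. x n + y n) \<in> ell p"
    and "ell_norm p (\<lambda>n. x n + y n) \<le> ell_norm p x + ell_norm p y" by auto
qed

lemma ell_diff:
  assumes "1 \<le> p" "x \<in> ell p" "y \<in> ell p"
  shows "(\<lambda>n. x n - y n) \<in> ell p"
  using ell_add[OF assms(1,2) ell_minus[OF assms(3)]] by simp

lemma ell_norm_eq_0:
  assumes p: "1 \<le> p" and x: "x \<in> ell p"
  shows "ell_norm p x = 0 \<longleftrightarrow> (\<forall>n. x n = 0)"
proof (cases "p = \<infinity>")
  case True
  have "bdd_above (range (\<lambda>n. cmod (x n)))"
    using x True by (auto simp: ell_def bounded_iff bdd_above_def)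
  then have "cmod (x n) \<le> ell_norm p x" for n
    using x True by (auto simp: ell_norm_def intro: cSUP_upper)
  then have "\<forall>n. x n = 0" if "ell_norm p x = 0"
    using that by (metis norm_le_zero_iff)
  moreover have "ell_norm p x = 0" if "\<forall>n. x n = 0"
    using that x True by (simp add: ell_norm_def)
  ultimately show ?thesis by blast
next
  case False
  have "summable (\<lambda>n. cmod (x n) powr enn2real p)"
    using x False by (simp add: ell_def)
  then show ?thesis
    using x False by (simp add: ell_norm_def suminf_eq_zero_iff)
qed

lemma Metric_space_ell:
  assumes "1 \<le> p"
  shows "Metric_space (ell p) (ell_dist p)"
proof
  fix x y z
  show "0 \<le> ell_dist p x y"
    by (simp add: ell_dist_def ell_norm_nonneg)
  show "ell_dist p x y = ell_dist p y x"
    using ell_norm_minus[of p "\<lambda>n. x n - y n"] by (simp add: ell_dist_def)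
  show "ell_dist p x y = 0 \<longleftrightarrow> x = y" if "x \<in> ell p" "y \<in> ell p"
    using ell_norm_eq_0[OF assms ell_diff[OF assms that]] by (auto simp: ell_dist_def)
  show "ell_dist p x z \<le> ell_dist p x y + ell_dist p y z"
    if "x \<in> ell p" "y \<in> ell p" "z \<in> ell p"
    using ell_norm_triangle[OF assms ell_diff[OF assms that(1,2)] ell_diff[OF assms that(2,3)]]
    by (simp add: ell_dist_def)
qed

end

theory Submission
  imports Defs
begin

text \<open>
  Write \<open>\<alpha> j = 1 / p j\<close> and \<open>s = \<Sum>j<m. \<alpha> j\<close>. All constants may depend on \<open>m\<close>, so it suffices to treat
  finite forms \<open>\<Sum>i. a i * (\<Prod>j<m. x j (i j))\<close> on \<open>N\<close>-dimensional unit balls, with constants that do not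
  depend on \<open>N\<close>.

  \<^emph>\<open>Upper bounds.\<close> For \<open>s = 0\<close>, averaging over signs in all variables (Khinchine for decoupled
  chaoses, \<open>chaos_Khinchine\<close>) shows that for every \<open>k\<close> the Euclidean norms of the slices \<open>i k = v\<close> of
  the coefficients are summable over \<open>v\<close> (\<open>mixed_1_2_inequality\<close>). In general this holds for the
  coefficients multiplied by fixed vectors of the unit balls. Choosing those vectors as suitable powers
  of the marginals of \<open>\<bar>a i\<bar>\<^sup>2\<close> removes one factor after the other (\<open>marginal_sums_bound\<close>): as
  long as \<open>s \<le> 1 / 2\<close>, the Euclidean norms of the slices are \<open>\<lambda>\<close>-summable. For \<open>s < 1 / 2\<close>, Blei's
  inequality (\<open>Blei_inequality\<close>) combines the \<open>m\<close> directions \<open>k\<close> into the exponent \<open>\<mu>\<close>. For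
  \<open>s \<ge> 1 / 2\<close>, every \<open>\<alpha> j\<close> is split in two parts such that the first ones add up to \<open>1 / 2\<close>; the
  first parts give a square-summable family, against vectors of the remaining spaces, and testing with
  marginals of \<open>\<bar>a i\<bar> powr \<lambda>\<close> yields the exponent \<open>\<lambda>\<close> (\<open>coefficients_large_sum\<close>).

  \<^emph>\<open>Optimality.\<close> By Hoelder the diagonal form \<open>\<Sum>n<N. \<Prod>j<m. x j n\<close> has norm at most
  \<open>N powr (1 - s)\<close>, while \<open>N\<close> of its coefficients are \<open>1\<close>; hence \<open>1 / t \<le> 1 - s\<close>
  for every admissible exponent \<open>t\<close>. If \<open>s < 1 / 2\<close>, all \<open>p j\<close> exceed \<open>2\<close>, and
  a form with random signs as coefficients has norm at most \<open>N powr ((m + 1) / 2 - s)\<close>, up to a logarithm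
  (\<open>random_form\<close>), with \<open>N ^ m\<close> coefficients of modulus \<open>1\<close>; hence \<open>m / t \<le> (m + 1) / 2 - s = m / \<mu>\<close>.
\<close>


section \<open>Decoupled sign chaoses\<close>

definition indices :: "nat \<Rightarrow> nat \<Rightarrow> (nat \<Rightarrow> nat) set" where
  "indices m N = (\<Pi>\<^sub>E j\<in>{..<m}. {..<N})"

definition signs :: "nat \<Rightarrow> (nat \<Rightarrow> real) set" where
  "signs N = (\<Pi>\<^sub>E n\<in>{..<N}. {-1, 1})"

definition sign_families :: "nat \<Rightarrow> nat \<Rightarrow> (nat \<Rightarrow> nat \<Rightarrow> real) set" where
  "sign_families m N = (\<Pi>\<^sub>E j\<in>{..<m}. signs N)"

definition chaos ::
    "nat \<Rightarrow> nat \<Rightarrow> ((nat \<Rightarrow> nat) \<Rightarrow> complex) \<Rightarrow> (nat \<Rightarrow> nat \<Rightarrow> real) \<Rightarrow> complex" where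
  "chaos m N c e = (\<Sum>i\<in>indices m N. c i * (\<Prod>j<m. complex_of_real (e j (i j))))"

lemma finite_indices [simp, intro]: "finite (indices m N)"
  by (auto simp: indices_def intro: finite_PiE)

lemma indices_0: "indices 0 N = {\<lambda>_. undefined}"
  by (simp add: indices_def)

lemma indices_less: "i \<in> indices m N \<Longrightarrow> j < m \<Longrightarrow> i j < N"
  by (auto simp: indices_def PiE_def)

lemma sum_PiE_insert:
  assumes "x \<notin> S"
  shows "(\<Sum>g\<in>PiE (insert x S) T. f g) = (\<Sum>y\<in>T x. \<Sum>g\<in>PiE S T. f (g(x := y)))"
  unfolding PiE_insert_eq
  by (subst sum.reindex[OF inj_combinator[OF assms]])
     (simp add: sum.cartesian_product case_prod_unfold)

lemma sum_indices_Suc: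
  "(\<Sum>i\<in>indices (Suc m) N. f i) = (\<Sum>v<N. \<Sum>i\<in>indices m N. f (i(m := v)))"
  unfolding indices_def lessThan_Suc by (rule sum_PiE_insert) simp

lemma sum_indices_0: "(\<Sum>i\<in>indices 0 N. f i) = f (\<lambda>_. undefined)"
  by (simp add: indices_def)

lemma sum_signs_Suc:
  "(\<Sum>e\<in>signs (Suc N). f e) = (\<Sum>e\<in>signs N. f (e(N := 1)) + f (e(N := -1)))"
  unfolding signs_def lessThan_Suc by (subst sum_PiE_insert) (auto simp: sum.distrib add.commute)

lemma sum_sign_families_Suc:
  "(\<Sum>e\<in>sign_families (Suc m) N. f e) = (\<Sum>e\<in>sign_families m N. \<Sum>s\<in>signs N. f (e(m := s)))"
  unfolding sign_families_def lessThan_Suc by (subst sum_PiE_insert) (auto intro: sum.swap)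

lemma card_signs: "card (signs N) = 2 ^ N"
  by (simp add: signs_def card_PiE numeral_2_eq_2)

lemma card_sign_families: "card (sign_families m N) = (2 ^ N) ^ m"
  by (simp add: sign_families_def card_PiE card_signs)

lemma abs_sign_family:
  "e \<in> sign_families m N \<Longrightarrow> j < m \<Longrightarrow> n < N \<Longrightarrow> \<bar>e j n\<bar> = 1"
  by (auto simp: sign_families_def signs_def dest!: PiE_mem)

lemma sum_indices_prod:
  fixes f :: "nat \<Rightarrow> nat \<Rightarrow> 'a :: comm_semiring_1"
  shows "(\<Sum>i\<in>indices m N. \<Prod>j<m. f j (i j)) = (\<Prod>j<m. \<Sum>n<N. f j n)"
  unfolding indices_def by (rule prod_sum_PiE[symmetric]) auto

lemma sign_sum_Suc:
  "(\<Sum>n<Suc N. complex_of_real ((e(N := y)) n) * c n)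
     = (\<Sum>n<N. complex_of_real (e n) * c n) + complex_of_real y * c N"
  by simp

lemma norm_fourth_parallelogram:
  fixes g c :: complex
  shows "cmod (g + c) ^ 4 + cmod (g - c) ^ 4
       \<le> 2 * (cmod g ^ 4 + 6 * (cmod g)\<^sup>2 * (cmod c)\<^sup>2 + cmod c ^ 4)"
proof -
  define P t where "P = (cmod g)\<^sup>2 + (cmod c)\<^sup>2" and "t = 2 * (g \<bullet> c)"
  have 1: "(cmod (g + c))\<^sup>2 = P + t" "(cmod (g - c))\<^sup>2 = P - t"
    by (simp_all add: P_def t_def power2_norm_eq_inner inner_simps inner_commute)
  have "t\<^sup>2 \<le> 4 * ((cmod g)\<^sup>2 * (cmod c)\<^sup>2)"
    using Cauchy_Schwarz_ineq[of g c]
    by (simp only: t_def power_mult_distrib flip: power2_norm_eq_inner) simp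
  moreover have "cmod (g + c) ^ 4 + cmod (g - c) ^ 4 = 2 * P\<^sup>2 + 2 * t\<^sup>2"
  proof -
    have "cmod (g + c) ^ 4 + cmod (g - c) ^ 4 = ((cmod (g + c))\<^sup>2)\<^sup>2 + ((cmod (g - c))\<^sup>2)\<^sup>2"
      by simp
    also have "\<dots> = 2 * P\<^sup>2 + 2 * t\<^sup>2"
      unfolding 1 by (simp add: power2_eq_square algebra_simps)
    finally show ?thesis .
  qed
  moreover have "P\<^sup>2 = cmod g ^ 4 + 2 * ((cmod g)\<^sup>2 * (cmod c)\<^sup>2) + cmod c ^ 4"
    by (simp add: P_def power2_eq_square algebra_simps power4_eq_xxxx)
  ultimately show ?thesis by (simp add: mult_ac)
qed

lemma norm_sq_parallelogram:
  fixes g c :: complex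
  shows "(cmod (g + c))\<^sup>2 + (cmod (g - c))\<^sup>2 = 2 * ((cmod g)\<^sup>2 + (cmod c)\<^sup>2)"
  by (simp add: power2_norm_eq_inner inner_simps inner_commute)

lemma sign_sum_second_moment:
  "(\<Sum>e\<in>signs N. (cmod (\<Sum>n<N. complex_of_real (e n) * c n))\<^sup>2) = 2 ^ N * (\<Sum>n<N. (cmod (c n))\<^sup>2)"
proof (induction N)
  case 0
  then show ?case by simp
next
  case (Suc N)
  show ?case
    unfolding sum_signs_Suc sign_sum_Suc using Suc
    by (simp add: norm_sq_parallelogram sum.distrib card_signs distrib_left flip: sum_distrib_left)
qed

text \<open>
  Adding one sign to a sum \<open>g\<close>, the odd terms cancel; the mixed term \<open>6 * \<bar>g\<bar>\<^sup>2 * \<bar>c N\<bar>\<^sup>2\<close> is what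
  determines the constant \<open>3\<close>.
\<close>

lemma sign_sum_fourth_moment:
  "(\<Sum>e\<in>signs N. cmod (\<Sum>n<N. complex_of_real (e n) * c n) ^ 4)
     \<le> 3 * 2 ^ N * (\<Sum>n<N. (cmod (c n))\<^sup>2)\<^sup>2"
proof (induction N)
  case 0
  then show ?case by simp
next
  case (Suc N)
  let ?g = "\<lambda>e. \<Sum>n<N. complex_of_real (e n) * c n"
  define A where "A = (\<Sum>n<N. (cmod (c n))\<^sup>2)"
  have "(\<Sum>e\<in>signs (Suc N). cmod (\<Sum>n<Suc N. complex_of_real (e n) * c n) ^ 4)
      = (\<Sum>e\<in>signs N. cmod (?g e + c N) ^ 4 + cmod (?g e - c N) ^ 4)"
    unfolding sum_signs_Suc sign_sum_Suc by simp
  also have "\<dots> \<le> (\<Sum>e\<in>signs N. 2 * (cmod (?g e) ^ 4 + 6 * (cmod (?g e))\<^sup>2 * (cmod (c N))\<^sup>2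
      + cmod (c N) ^ 4))"
    by (intro sum_mono norm_fourth_parallelogram)
  also have "\<dots> = 2 * ((\<Sum>e\<in>signs N. cmod (?g e) ^ 4)
      + 6 * (cmod (c N))\<^sup>2 * (\<Sum>e\<in>signs N. (cmod (?g e))\<^sup>2) + 2 ^ N * cmod (c N) ^ 4)"
    by (simp add: sum.distrib card_signs algebra_simps sum_distrib_left)
  also have "\<dots> \<le> 2 * (3 * 2 ^ N * A\<^sup>2 + 6 * (cmod (c N))\<^sup>2 * (2 ^ N * A) + 2 ^ N * cmod (c N) ^ 4)"
    using Suc.IH unfolding sign_sum_second_moment A_def by simp
  also have "\<dots> \<le> 3 * 2 ^ Suc N * (A + (cmod (c N))\<^sup>2)\<^sup>2"
    by (simp add: power2_eq_square algebra_simps power4_eq_xxxx)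
  finally show ?case by (simp add: A_def)
qed

lemma chaos_Suc:
  "chaos (Suc m) N c (e(m := s))
     = (\<Sum>v<N. complex_of_real (s v) * chaos m N (\<lambda>i. c (i(m := v))) e)"
proof -
  have *: "(\<Prod>j<m. complex_of_real ((e(m := s)) j ((i(m := v)) j)))
      = (\<Prod>j<m. complex_of_real (e j (i j)))" for i v
    by (intro prod.cong) auto
  show ?thesis
    unfolding chaos_def sum_indices_Suc sum_distrib_left
    by (intro sum.cong) (auto simp: * algebra_simps simp del: fun_upd_apply, simp)
qed

lemma chaos_second_moment:
  "(\<Sum>e\<in>sign_families m N. (cmod (chaos m N c e))\<^sup>2)
     = (2 ^ N) ^ m * (\<Sum>i\<in>indices m N. (cmod (c i))\<^sup>2)"
proof (induction m arbitrary: c)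
  case 0
  then show ?case by (simp add: sign_families_def chaos_def sum_indices_0)
next
  case (Suc m)
  have "(\<Sum>e\<in>sign_families (Suc m) N. (cmod (chaos (Suc m) N c e))\<^sup>2)
      = (\<Sum>e\<in>sign_families m N. 2 ^ N * (\<Sum>v<N. (cmod (chaos m N (\<lambda>i. c (i(m := v))) e))\<^sup>2))"
    unfolding sum_sign_families_Suc chaos_Suc sign_sum_second_moment ..
  also have "\<dots> = 2 ^ N * (\<Sum>v<N. \<Sum>e\<in>sign_families m N. (cmod (chaos m N (\<lambda>i. c (i(m := v))) e))\<^sup>2)"
    by (subst sum.swap) (simp add: sum_distrib_left)
  also have "\<dots> = (2 ^ N) ^ Suc m * (\<Sum>i\<in>indices (Suc m) N. (cmod (c i))\<^sup>2)"
    unfolding Suc sum_indices_Suc by (simp add: sum_distrib_left algebra_simps)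
  finally show ?case .
qed

lemma Cauchy_Schwarz_sum_sqrt:
  fixes f g :: "'a \<Rightarrow> real"
  shows "(\<Sum>x\<in>A. f x * g x) \<le> sqrt (\<Sum>x\<in>A. (f x)\<^sup>2) * sqrt (\<Sum>x\<in>A. (g x)\<^sup>2)"
  using Cauchy_Schwarz_ineq_sum[of f g A]
  by (metis real_le_rsqrt real_sqrt_mult)

text \<open>
  Conditioning on the first \<open>m\<close> families, the last one contributes a factor \<open>3\<close> and leaves the
  square of \<open>\<Sum>v. \<bar>g v\<bar>\<^sup>2\<close>, where \<open>g v\<close> is the chaos of the \<open>v\<close>-th slice; Cauchy--Schwarz
  separates the slices again.
\<close>

lemma chaos_fourth_moment:
  "(\<Sum>e\<in>sign_families m N. cmod (chaos m N c e) ^ 4)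
     \<le> 3 ^ m * (2 ^ N) ^ m * (\<Sum>i\<in>indices m N. (cmod (c i))\<^sup>2)\<^sup>2"
proof (induction m arbitrary: c)
  case 0
  then show ?case by (simp add: sign_families_def chaos_def sum_indices_0)
next
  case (Suc m)
  define g where "g v e = chaos m N (\<lambda>i. c (i(m := v))) e" for v e
  define S where "S v = (\<Sum>i\<in>indices m N. (cmod (c (i(m := v))))\<^sup>2)" for v
  have S0: "S v \<ge> 0" for v
    by (simp add: S_def sum_nonneg)
  have "(\<Sum>e\<in>sign_families (Suc m) N. cmod (chaos (Suc m) N c e) ^ 4)
      \<le> (\<Sum>e\<in>sign_families m N. 3 * 2 ^ N * (\<Sum>v<N. (cmod (g v e))\<^sup>2)\<^sup>2)"
    unfolding sum_sign_families_Suc chaos_Suc g_def by (intro sum_mono sign_sum_fourth_moment)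
  also have "\<dots> = 3 * 2 ^ N * (\<Sum>v<N. \<Sum>w<N. \<Sum>e\<in>sign_families m N. (cmod (g v e))\<^sup>2 * (cmod (g w e))\<^sup>2)"
  proof -
    have "(\<Sum>v<N. (cmod (g v e))\<^sup>2)\<^sup>2 = (\<Sum>v<N. \<Sum>w<N. (cmod (g v e))\<^sup>2 * (cmod (g w e))\<^sup>2)" for e
      by (simp only: power2_eq_square[of "sum _ _"] sum_product)
    moreover have "(\<Sum>e\<in>sign_families m N. \<Sum>v<N. \<Sum>w<N. (cmod (g v e))\<^sup>2 * (cmod (g w e))\<^sup>2)
        = (\<Sum>v<N. \<Sum>w<N. \<Sum>e\<in>sign_families m N. (cmod (g v e))\<^sup>2 * (cmod (g w e))\<^sup>2)"
      by (subst sum.swap, rule sum.cong[OF refl], rule sum.swap)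
    ultimately show ?thesis
      by (simp flip: sum_distrib_left)
  qed
  also have "\<dots> \<le> 3 * 2 ^ N * (\<Sum>v<N. \<Sum>w<N. sqrt (3 ^ m * (2 ^ N) ^ m) * S v * (sqrt (3 ^ m * (2 ^ N) ^ m) * S w))"
  proof (intro mult_left_mono sum_mono)
    fix v w
    have 4: "sqrt (\<Sum>e\<in>sign_families m N. ((cmod (g v e))\<^sup>2)\<^sup>2) \<le> sqrt (3 ^ m * (2 ^ N) ^ m) * S v" for v
    proof -
      have "sqrt (\<Sum>e\<in>sign_families m N. ((cmod (g v e))\<^sup>2)\<^sup>2) \<le> sqrt (3 ^ m * (2 ^ N) ^ m * (S v)\<^sup>2)"
        using Suc.IH[of "\<lambda>i. c (i(m := v))"] by (simp add: g_def S_def)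
      also have "\<dots> = sqrt (3 ^ m * (2 ^ N) ^ m) * S v"
        using S0 by (simp add: real_sqrt_mult)
      finally show ?thesis .
    qed
    have "(\<Sum>e\<in>sign_families m N. (cmod (g v e))\<^sup>2 * (cmod (g w e))\<^sup>2)
        \<le> sqrt (\<Sum>e\<in>sign_families m N. ((cmod (g v e))\<^sup>2)\<^sup>2) * sqrt (\<Sum>e\<in>sign_families m N. ((cmod (g w e))\<^sup>2)\<^sup>2)"
      by (rule Cauchy_Schwarz_sum_sqrt)
    also have "\<dots> \<le> sqrt (3 ^ m * (2 ^ N) ^ m) * S v * (sqrt (3 ^ m * (2 ^ N) ^ m) * S w)"
      using S0 by (intro mult_mono 4) (auto intro: sum_nonneg)
    finally show "(\<Sum>e\<in>sign_families m N. (cmod (g v e))\<^sup>2 * (cmod (g w e))\<^sup>2)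
        \<le> sqrt (3 ^ m * (2 ^ N) ^ m) * S v * (sqrt (3 ^ m * (2 ^ N) ^ m) * S w)" .
  qed auto
  also have "\<dots> = 3 * 2 ^ N * (sqrt (3 ^ m * (2 ^ N) ^ m) * (\<Sum>v<N. S v))\<^sup>2"
    by (simp only: power2_eq_square flip: sum_product sum_distrib_left sum_distrib_right)
  also have "\<dots> = 3 ^ Suc m * (2 ^ N) ^ Suc m * (\<Sum>v<N. S v)\<^sup>2"
    by (simp add: power_mult_distrib)
  finally show ?case
    by (simp add: sum_indices_Suc S_def)
qed

text \<open>
  Cauchy--Schwarz bounds the square of the second moment by the first times the third, and the square
  of the third by the second times the fourth; eliminate the third.
\<close>

lemma moment_interpolation:
  fixes F :: "'a \<Rightarrow> real"
  assumes "\<And>x. x \<in> A \<Longrightarrow> F x \<ge> 0"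
  shows "(\<Sum>x\<in>A. (F x)\<^sup>2) ^ 3 \<le> (\<Sum>x\<in>A. F x)\<^sup>2 * (\<Sum>x\<in>A. F x ^ 4)"
proof -
  define M where "M k = (\<Sum>x\<in>A. F x ^ k)" for k
  have M0: "M k \<ge> 0" for k
    using assms by (auto simp: M_def intro!: sum_nonneg)
  have "(\<Sum>x\<in>A. sqrt (F x) * (sqrt (F x) * F x))\<^sup>2 \<le> (\<Sum>x\<in>A. (sqrt (F x))\<^sup>2) * (\<Sum>x\<in>A. (sqrt (F x) * F x)\<^sup>2)"
    by (rule Cauchy_Schwarz_ineq_sum)
  also have "(\<Sum>x\<in>A. sqrt (F x) * (sqrt (F x) * F x)) = M 2"
    unfolding M_def using assms by (intro sum.cong) (auto simp: power2_eq_square simp flip: mult.assoc)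
  also have "(\<Sum>x\<in>A. (sqrt (F x))\<^sup>2) = M 1"
    unfolding M_def using assms by (intro sum.cong) auto
  also have "(\<Sum>x\<in>A. (sqrt (F x) * F x)\<^sup>2) = M 3"
    unfolding M_def using assms by (intro sum.cong) (auto simp: power_mult_distrib power2_eq_square power3_eq_cube)
  finally have 1: "(M 2)\<^sup>2 \<le> M 1 * M 3" .
  have 2: "(M 3)\<^sup>2 \<le> M 2 * M 4"
    using Cauchy_Schwarz_ineq_sum[of "\<lambda>x. F x" "\<lambda>x. (F x)\<^sup>2" A]
    by (simp add: M_def power2_eq_square power3_eq_cube power4_eq_xxxx mult.assoc)
  have "M 2 * (M 2) ^ 3 = ((M 2)\<^sup>2)\<^sup>2"
    by (simp add: power2_eq_square power3_eq_cube)
  also have "\<dots> \<le> (M 1 * M 3)\<^sup>2"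
    using 1 by (intro power_mono) auto
  also have "\<dots> \<le> (M 1)\<^sup>2 * (M 2 * M 4)"
    unfolding power_mult_distrib using 2 by (intro mult_left_mono) auto
  finally have 3: "M 2 * (M 2) ^ 3 \<le> M 2 * ((M 1)\<^sup>2 * M 4)"
    by (simp add: algebra_simps)
  have "M 2 ^ 3 \<le> (M 1)\<^sup>2 * M 4"
  proof (cases "M 2 = 0")
    case False
    then show ?thesis using 3 M0[of 2] by (simp add: less_le)
  qed (use M0[of 4] in auto)
  then show ?thesis by (simp add: M_def)
qed

text \<open>
  The first moment controls the second because the fourth moment does: this is the multiple
  Khinchine inequality between \<open>L\<^sub>1\<close> and \<open>L\<^sub>2\<close>, with constant \<open>(\<surd>3) ^ m\<close>.
\<close>

lemma chaos_Khinchine: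
  "(2 ^ N) ^ m * sqrt (\<Sum>i\<in>indices m N. (cmod (c i))\<^sup>2)
     \<le> sqrt 3 ^ m * (\<Sum>e\<in>sign_families m N. cmod (chaos m N c e))"
proof -
  define S where "S = (\<Sum>i\<in>indices m N. (cmod (c i))\<^sup>2)"
  define L where "L = (\<Sum>e\<in>sign_families m N. cmod (chaos m N c e))"
  define W where "W = (2 ^ N :: real) ^ m"
  have W: "W > 0" by (simp add: W_def)
  have S0: "S \<ge> 0" and L0: "L \<ge> 0" by (auto simp: S_def L_def intro: sum_nonneg)
  have "(W * S) ^ 3 \<le> L\<^sup>2 * (3 ^ m * W * S\<^sup>2)"
    using moment_interpolation[of "sign_families m N" "\<lambda>e. cmod (chaos m N c e)"]
      chaos_second_moment[of m N c] mult_left_mono[OF chaos_fourth_moment[of m N c], of "L\<^sup>2"]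
    by (simp add: S_def L_def W_def)
  then have "(W * S\<^sup>2) * (W\<^sup>2 * S) \<le> (W * S\<^sup>2) * (3 ^ m * L\<^sup>2)"
    by (simp add: power2_eq_square power3_eq_cube algebra_simps)
  then have "W\<^sup>2 * S \<le> 3 ^ m * L\<^sup>2"
    using W S0 by (cases "S = 0") (auto simp: mult_le_cancel_left_pos)
  then have "sqrt (W\<^sup>2 * S) \<le> sqrt (3 ^ m * L\<^sup>2)"
    by (rule real_sqrt_le_mono)
  then show ?thesis
    using W L0 unfolding real_sqrt_mult real_sqrt_power[of 3]
    by (simp add: S_def[symmetric] L_def[symmetric] W_def[symmetric])
qed

text \<open>
  Averaged over all signs, the square root on the left is at most \<open>(\<surd>3) ^ m\<close> times the slice
  \<open>i k = v\<close> of the chaos. For fixed signs the absolute values of the slices add up to a single value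
  of the form: correct the signs of the \<open>k\<close>-th family by the phases of the slices.
\<close>

lemma mixed_1_2_inequality:
  assumes bound: "\<And>x. (\<And>j n. j < m \<Longrightarrow> n < N \<Longrightarrow> cmod (x j n) \<le> 1) \<Longrightarrow>
      cmod (\<Sum>i\<in>indices m N. c i * (\<Prod>j<m. x j (i j))) \<le> M"
    and k: "k < m"
  shows "(\<Sum>v<N. sqrt (\<Sum>i\<in>{i\<in>indices m N. i k = v}. (cmod (c i))\<^sup>2)) \<le> sqrt 3 ^ m * M"
proof -
  define d where "d v i = (if i k = v then c i else 0)" for v i
  have slice: "(\<Sum>v<N. cmod (chaos m N (d v) e)) \<le> M" if e: "e \<in> sign_families m N" for e
  proof -
    define z where "z v = (let w = chaos m N (d v) e in if w = 0 then 1 else cnj w / cmod w)" for v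
    have z: "z v * chaos m N (d v) e = cmod (chaos m N (d v) e)" "cmod (z v) = 1" for v
      by (auto simp: z_def Let_def norm_divide complex_norm_square[symmetric] power2_eq_square mult.commute)
    define x where "x j n = (if j = k then z n else 1) * complex_of_real (e j n)" for j n
    have "(\<Prod>j<m. x j (i j)) = z (i k) * (\<Prod>j<m. complex_of_real (e j (i j)))" for i
      unfolding x_def prod.distrib using k by (simp add: if_distrib[of "\<lambda>f. f _"] prod.If_cases Int_def)
    then have "(\<Sum>i\<in>indices m N. c i * (\<Prod>j<m. x j (i j)))
        = (\<Sum>i\<in>indices m N. \<Sum>v<N. z v * (d v i * (\<Prod>j<m. complex_of_real (e j (i j)))))"
      using k by (intro sum.cong refl)
        (auto simp: d_def if_distrib if_distribR sum.delta indices_less cong: if_cong)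
    also have "\<dots> = (\<Sum>v<N. z v * chaos m N (d v) e)"
      by (subst sum.swap) (simp add: chaos_def sum_distrib_left)
    also have "\<dots> = complex_of_real (\<Sum>v<N. cmod (chaos m N (d v) e))"
      by (simp add: z)
    finally have "(\<Sum>v<N. cmod (chaos m N (d v) e)) = cmod (\<Sum>i\<in>indices m N. c i * (\<Prod>j<m. x j (i j)))"
      by (simp add: sum_nonneg del: of_real_sum)
    also have "\<dots> \<le> M"
      using e by (intro bound) (auto simp: x_def norm_mult z abs_sign_family)
    finally show ?thesis .
  qed
  have "(2 ^ N) ^ m * (\<Sum>v<N. sqrt (\<Sum>i\<in>{i\<in>indices m N. i k = v}. (cmod (c i))\<^sup>2))
      = (\<Sum>v<N. (2 ^ N) ^ m * sqrt (\<Sum>i\<in>indices m N. (cmod (d v i))\<^sup>2))"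
    unfolding sum_distrib_left d_def
    by (simp add: sum.inter_filter if_distrib[of "\<lambda>z. (cmod z)\<^sup>2"] cong: if_cong)
  also have "\<dots> \<le> (\<Sum>v<N. sqrt 3 ^ m * (\<Sum>e\<in>sign_families m N. cmod (chaos m N (d v) e)))"
    by (intro sum_mono chaos_Khinchine)
  also have "\<dots> = sqrt 3 ^ m * (\<Sum>e\<in>sign_families m N. \<Sum>v<N. cmod (chaos m N (d v) e))"
    by (subst sum.swap) (simp add: sum_distrib_left)
  also have "\<dots> \<le> sqrt 3 ^ m * (\<Sum>e\<in>sign_families m N. M)"
    by (intro mult_left_mono sum_mono slice) auto
  finally show ?thesis
    by (simp add: card_sign_families algebra_simps)
qed

section \<open>Sums of marginals\<close>

definition weights :: "nat \<Rightarrow> (nat \<Rightarrow> real) \<Rightarrow> bool" where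
  "weights N u \<longleftrightarrow> (\<forall>n<N. 0 \<le> u n) \<and> (\<Sum>n<N. u n) \<le> 1"

text \<open>
  With reciprocal exponents \<open>a = 1 / p\<close>, a vector \<open>x\<close> lies in the unit ball of \<open>\<ell>\<^sub>p\<close> iff
  \<open>\<bar>x n\<bar> \<le> wpow (u n) a\<close> for some weights \<open>u\<close>. The convention \<open>wpow 0 0 = 1\<close>, which \<open>powr\<close> does not
  have, makes this true for \<open>p = \<infinity>\<close> as well.
\<close>

definition wpow :: "real \<Rightarrow> real \<Rightarrow> real" where
  "wpow u a = (if a = 0 then 1 else u powr a)"

lemma wpow_nonneg [simp]: "0 \<le> wpow u a"
  by (simp add: wpow_def)

lemma wpow_power2: "(wpow u a)\<^sup>2 = wpow u (2 * a)"
  by (simp add: wpow_def power2_eq_square flip: powr_add)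

lemma weights_nonneg: "weights N u \<Longrightarrow> n < N \<Longrightarrow> 0 \<le> u n"
  by (simp add: weights_def)

lemma Young_nonneg:
  fixes a b :: real
  assumes "0 \<le> \<alpha>" "0 \<le> \<beta>" "\<alpha> + \<beta> = 1" "0 \<le> a" "0 \<le> b"
  shows "a powr \<alpha> * b powr \<beta> \<le> \<alpha> * a + \<beta> * b"
  using assms Youngs_inequality_0[of \<alpha> \<beta> a b] by (cases "a = 0 \<or> b = 0") auto

lemma Holder_sum_powr:
  fixes x y :: "'a \<Rightarrow> real"
  assumes "finite A" and x: "\<And>i. i \<in> A \<Longrightarrow> 0 \<le> x i" and y: "\<And>i. i \<in> A \<Longrightarrow> 0 \<le> y i"
    and ab: "0 \<le> \<alpha>" "0 \<le> \<beta>" "\<alpha> + \<beta> = 1"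
  shows "(\<Sum>i\<in>A. x i powr \<alpha> * y i powr \<beta>) \<le> (\<Sum>i\<in>A. x i) powr \<alpha> * (\<Sum>i\<in>A. y i) powr \<beta>"
proof -
  define X Y where "X = (\<Sum>i\<in>A. x i)" and "Y = (\<Sum>i\<in>A. y i)"
  have XY: "X \<ge> 0" "Y \<ge> 0"
    using x y by (auto simp: X_def Y_def intro: sum_nonneg)
  show ?thesis
  proof (cases "X = 0 \<or> Y = 0")
    case True
    then have "x i = 0 \<or> y i = 0" if "i \<in> A" for i
      using that assms sum_nonneg_eq_0_iff[of A x] sum_nonneg_eq_0_iff[of A y]
      by (auto simp: X_def Y_def)
    then have "(\<Sum>i\<in>A. x i powr \<alpha> * y i powr \<beta>) = 0"
      by (intro sum.neutral) auto
    then show ?thesis by simp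
  next
    case False
    then have pos: "X > 0" "Y > 0" using XY by auto
    have "(\<Sum>i\<in>A. x i powr \<alpha> * y i powr \<beta>)
        = X powr \<alpha> * Y powr \<beta> * (\<Sum>i\<in>A. (x i / X) powr \<alpha> * (y i / Y) powr \<beta>)"
      using pos by (simp add: powr_divide sum_distrib_left)
    also have "\<dots> \<le> X powr \<alpha> * Y powr \<beta> * (\<Sum>i\<in>A. \<alpha> * (x i / X) + \<beta> * (y i / Y))"
      using x y pos ab by (intro mult_left_mono sum_mono Young_nonneg) auto
    also have "(\<Sum>i\<in>A. \<alpha> * (x i / X) + \<beta> * (y i / Y)) = \<alpha> * (X / X) + \<beta> * (Y / Y)"
      by (simp add: X_def Y_def sum.distrib flip: sum_distrib_left sum_divide_distrib)
    finally show ?thesis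
      using pos ab by (simp flip: X_def Y_def)
  qed
qed

lemma powr_quotient_powr:
  fixes a b :: real
  assumes "0 < b"
  shows "(a powr x / b) powr y = a powr (x * y) * b powr (- y)"
  using assms by (simp add: powr_divide powr_powr powr_minus_divide)

text \<open>
  The hypothesis tests \<open>C\<close> against the weights \<open>u\<close>; the extremal choice in the duality between
  \<open>\<ell>\<close>-spaces is \<open>u\<close> proportional to \<open>C powr (\<lambda> / 2)\<close>.
\<close>

lemma remove_weight_same_index:
  fixes C :: "'b \<Rightarrow> real"
  assumes fin: "finite J" and C: "\<And>j. j \<in> J \<Longrightarrow> 0 \<le> C j" and D: "0 < D"
    and r: "0 < r" and lam: "0 < lam" "1 / lam = 1 / r - \<alpha>" and al: "0 < \<alpha>"
    and A: "\<And>u. (\<And>j. j \<in> J \<Longrightarrow> 0 \<le> u j) \<Longrightarrow> (\<Sum>j\<in>J. u j) \<le> 1 \<Longrightarrow>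
      (\<Sum>j\<in>J. (C j * u j powr (2 * \<alpha>)) powr (r / 2)) \<le> D powr r"
  shows "(\<Sum>j\<in>J. C j powr (lam / 2)) \<le> D powr lam"
proof -
  define L where "L = (\<Sum>j\<in>J. C j powr (lam / 2))"
  have "L \<ge> 0" by (simp add: L_def sum_nonneg)
  show ?thesis
  proof (cases "L = 0")
    case False
    with \<open>L \<ge> 0\<close> have L: "L > 0" by simp
    have lr: "(1 + lam * \<alpha>) * (r / 2) = lam / 2" and rl: "1 + - (\<alpha> * r) = r / lam"
      using lam r by (simp_all add: field_simps)
    have "(C j * (C j powr (lam / 2) / L) powr (2 * \<alpha>)) powr (r / 2)
        = C j powr (lam / 2) * L powr (- (\<alpha> * r))" if "j \<in> J" for j
    proof (cases "C j = 0")
      case False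
      with C[OF that] have c: "C j > 0" by simp
      have "(C j * (C j powr (lam / 2) / L) powr (2 * \<alpha>)) powr (r / 2)
          = (C j powr (1 + lam * \<alpha>) * L powr (- (2 * \<alpha>))) powr (r / 2)"
        using c powr_quotient_powr[OF L, of "C j" "lam / 2" "2 * \<alpha>"]
        by (simp add: powr_mult_base flip: mult.assoc)
      also have "\<dots> = C j powr ((1 + lam * \<alpha>) * (r / 2)) * L powr (- (2 * \<alpha>) * (r / 2))"
        by (simp only: powr_mult powr_powr)
      finally show ?thesis unfolding lr by simp
    qed simp
    then have "L * L powr (- (\<alpha> * r)) = (\<Sum>j\<in>J. (C j * (C j powr (lam / 2) / L) powr (2 * \<alpha>)) powr (r / 2))"
      by (simp add: L_def sum_distrib_right)
    also have "\<dots> \<le> D powr r"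
      using L by (intro A) (auto simp: L_def simp flip: sum_divide_distrib)
    finally have "L powr (r / lam) \<le> D powr r"
      using L powr_mult_base[of L "- (\<alpha> * r)"] unfolding rl by simp
    then have "(L powr (r / lam)) powr (lam / r) \<le> (D powr r) powr (lam / r)"
      using r lam by (intro powr_mono2) auto
    then show ?thesis
      using r lam L by (simp add: powr_powr L_def)
  qed (simp add: L_def)
qed

text \<open>
  Take \<open>u\<close> proportional to the \<open>\<lambda>/2\<close>-th power of the column sums \<open>C\<close>. The weighted row sums \<open>H\<close>
  carry the positive power \<open>\<lambda> \<alpha>\<close> of \<open>C\<close>; the sums \<open>K\<close> with the negative power \<open>\<lambda> / 2 - 1\<close> add up to
  \<open>\<Sum>j. C j powr (\<lambda> / 2)\<close>. By Hoelder inside a row the plain row sum is at most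
  \<open>H powr \<theta> * K powr (1 - \<theta>)\<close>, where \<open>\<theta>\<close> cancels the powers of \<open>C\<close>, and a second application of
  Hoelder, over the rows, has exponents that add up to \<open>1\<close> for the same \<open>\<theta>\<close>.
\<close>

lemma remove_weight_other_index:
  fixes b :: "'a \<Rightarrow> 'b \<Rightarrow> real"
  assumes fin: "finite I" "finite J" and b: "\<And>i j. i \<in> I \<Longrightarrow> j \<in> J \<Longrightarrow> 0 \<le> b i j" and D: "0 < D"
    and r: "0 < r" and lam: "0 < lam" "lam \<le> 2" "1 / lam = 1 / r - \<alpha>" and al: "0 < \<alpha>"
    and A: "\<And>u. (\<And>j. j \<in> J \<Longrightarrow> 0 \<le> u j) \<Longrightarrow> (\<Sum>j\<in>J. u j) \<le> 1 \<Longrightarrow>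
      (\<Sum>i\<in>I. (\<Sum>j\<in>J. b i j * u j powr (2 * \<alpha>)) powr (r / 2)) \<le> D powr r"
    and B: "(\<Sum>j\<in>J. (\<Sum>i\<in>I. b i j) powr (lam / 2)) \<le> D powr lam"
  shows "(\<Sum>i\<in>I. (\<Sum>j\<in>J. b i j) powr (lam / 2)) \<le> D powr lam"
proof (cases "lam = 2")
  case True
  have "(\<Sum>i\<in>I. (\<Sum>j\<in>J. b i j) powr 1) = (\<Sum>j\<in>J. (\<Sum>i\<in>I. b i j) powr 1)"
    using b by (simp add: sum_nonneg sum.swap[of _ I])
  then show ?thesis using B True by simp
next
  case False
  define \<kappa> where "\<kappa> = 1 / lam - 1 / 2"
  have kappa: "\<kappa> > 0" using lam False by (simp add: \<kappa>_def field_simps)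
  define \<theta> where "\<theta> = \<kappa> / (\<alpha> + \<kappa>)"
  have th: "0 < \<theta>" "\<theta> < 1" "\<theta> * \<alpha> = (1 - \<theta>) * \<kappa>"
    using kappa al by (simp_all add: \<theta>_def field_simps)
  have lamk: "1 - lam / 2 = lam * \<kappa>" and lr: "r + r * (lam * \<alpha>) = lam" and lr': "lam / r = 1 + lam * \<alpha>"
    using lam r by (simp_all add: \<kappa>_def field_simps)
  define C where "C j = (\<Sum>i\<in>I. b i j)" for j
  define H where "H i = (\<Sum>j\<in>J. b i j * C j powr (lam * \<alpha>))" for i
  define K where "K i = (\<Sum>j\<in>J. b i j * C j powr (- (lam * \<kappa>)))" for i
  have C0: "C j \<ge> 0" if "j \<in> J" for j
    using b that by (auto simp: C_def intro: sum_nonneg)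
  have H0: "H i \<ge> 0" and K0: "K i \<ge> 0" if "i \<in> I" for i
    using b that by (auto simp: H_def K_def intro!: sum_nonneg)
  have bC: "b i j \<le> C j" if "i \<in> I" "j \<in> J" for i j
    using that b fin unfolding C_def by (intro member_le_sum) auto
  have sumH: "(\<Sum>i\<in>I. H i powr (r / 2)) \<le> D powr lam"
  proof -
    define u where "u j = C j powr (lam / 2) / D powr lam" for j
    have Hu: "(\<Sum>j\<in>J. b i j * u j powr (2 * \<alpha>)) = H i * D powr (- (2 * \<alpha> * lam))" for i
      unfolding H_def sum_distrib_right u_def powr_quotient_powr[OF powr_gt_zero[THEN iffD2, OF less_imp_neq[OF D, symmetric]]]
      by (intro sum.cong refl) (simp add: powr_powr mult_ac)
    have "(\<Sum>i\<in>I. (\<Sum>j\<in>J. b i j * u j powr (2 * \<alpha>)) powr (r / 2)) \<le> D powr r"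
      using B D by (intro A) (auto simp: u_def C_def divide_simps simp flip: sum_divide_distrib)
    then have "(\<Sum>i\<in>I. (H i * D powr (- (2 * \<alpha> * lam))) powr (r / 2)) \<le> D powr r"
      unfolding Hu .
    also have "(\<Sum>i\<in>I. (H i * D powr (- (2 * \<alpha> * lam))) powr (r / 2))
        = (\<Sum>i\<in>I. H i powr (r / 2)) * D powr (- (r * (lam * \<alpha>)))"
      unfolding sum_distrib_right by (intro sum.cong refl) (simp add: powr_mult powr_powr mult_ac)
    finally have "(\<Sum>i\<in>I. H i powr (r / 2)) \<le> D powr r * D powr (r * (lam * \<alpha>))"
      using D by (simp add: powr_minus_divide pos_divide_le_eq)
    then show ?thesis by (simp only: lr flip: powr_add)
  qed
  have sumK: "(\<Sum>i\<in>I. K i) \<le> D powr lam"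
  proof -
    have "(\<Sum>i\<in>I. K i) = (\<Sum>j\<in>J. C j * C j powr (- (lam * \<kappa>)))"
      unfolding K_def by (subst sum.swap) (simp add: C_def sum_distrib_right)
    also have "\<dots> = (\<Sum>j\<in>J. C j powr (lam / 2))"
    proof (intro sum.cong refl)
      fix j assume "j \<in> J"
      have e: "1 + - (lam * \<kappa>) = lam / 2" using lamk by simp
      show "C j * C j powr (- (lam * \<kappa>)) = C j powr (lam / 2)"
        using powr_mult_base[OF C0[OF \<open>j \<in> J\<close>], of "- (lam * \<kappa>)"] unfolding e .
    qed
    finally show ?thesis using B by (simp add: C_def)
  qed
  have row: "(\<Sum>j\<in>J. b i j) \<le> H i powr \<theta> * K i powr (1 - \<theta>)" if "i \<in> I" for i
  proof -
    have "b i j = (b i j * C j powr (lam * \<alpha>)) powr \<theta> * (b i j * C j powr (- (lam * \<kappa>))) powr (1 - \<theta>)"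
      if "j \<in> J" for j
    proof (cases "b i j = 0")
      case False
      then have pos: "b i j > 0" "C j > 0"
        using b[OF \<open>i \<in> I\<close> that] bC[OF \<open>i \<in> I\<close> that] by auto
      have "(b i j * C j powr (lam * \<alpha>)) powr \<theta> * (b i j * C j powr (- (lam * \<kappa>))) powr (1 - \<theta>)
          = b i j powr (\<theta> + (1 - \<theta>)) * C j powr (lam * (\<theta> * \<alpha>) - lam * ((1 - \<theta>) * \<kappa>))"
      proof -
        have "C j powr (lam * (\<theta> * \<alpha>) - lam * ((1 - \<theta>) * \<kappa>))
            = C j powr (lam * \<alpha> * \<theta>) * C j powr (- (lam * \<kappa>) * (1 - \<theta>))"
          unfolding powr_add[symmetric] by (simp add: algebra_simps)
        then show ?thesis
          unfolding powr_mult powr_powr powr_add by simp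
      qed
      then show ?thesis using pos th by simp
    qed simp
    then have "(\<Sum>j\<in>J. b i j)
        = (\<Sum>j\<in>J. (b i j * C j powr (lam * \<alpha>)) powr \<theta> * (b i j * C j powr (- (lam * \<kappa>))) powr (1 - \<theta>))"
      by (intro sum.cong) auto
    also have "\<dots> \<le> H i powr \<theta> * K i powr (1 - \<theta>)"
      unfolding H_def K_def using b that th fin by (intro Holder_sum_powr) auto
    finally show ?thesis .
  qed
  define p q where "p = \<theta> * (lam / r)" and "q = (1 - \<theta>) * (lam / 2)"
  have pq: "p \<ge> 0" "q \<ge> 0" using th lam r by (auto simp: p_def q_def)
  have pq1: "p + q = 1"
  proof -
    have h: "lam / 2 = 1 - lam * \<kappa>" using lamk by simp
    have "p + q = 1 + lam * (\<theta> * \<alpha> - (1 - \<theta>) * \<kappa>)"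
      unfolding p_def q_def lr' h by (simp add: algebra_simps)
    then show ?thesis using th by simp
  qed
  have "(\<Sum>i\<in>I. (\<Sum>j\<in>J. b i j) powr (lam / 2)) \<le> (\<Sum>i\<in>I. (H i powr (r / 2)) powr p * K i powr q)"
  proof (intro sum_mono)
    fix i assume i: "i \<in> I"
    have "(\<Sum>j\<in>J. b i j) powr (lam / 2) \<le> (H i powr \<theta> * K i powr (1 - \<theta>)) powr (lam / 2)"
      using row[OF i] lam b i by (intro powr_mono2) (auto intro: sum_nonneg)
    also have "\<dots> = (H i powr (r / 2)) powr p * K i powr q"
      using H0[OF i] K0[OF i] r by (simp add: powr_mult powr_powr p_def q_def)
    finally show "(\<Sum>j\<in>J. b i j) powr (lam / 2) \<le> (H i powr (r / 2)) powr p * K i powr q" .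
  qed
  also have "\<dots> \<le> (\<Sum>i\<in>I. H i powr (r / 2)) powr p * (\<Sum>i\<in>I. K i) powr q"
    using fin K0 pq pq1 by (intro Holder_sum_powr) auto
  also have "\<dots> \<le> (D powr lam) powr p * (D powr lam) powr q"
    using sumH sumK pq K0 by (intro mult_mono powr_mono2) (auto intro: sum_nonneg)
  also have "\<dots> = D powr lam"
    using pq1 D by (simp flip: powr_add)
  finally show ?thesis .
qed

definition slice :: "nat \<Rightarrow> nat \<Rightarrow> nat \<Rightarrow> nat \<Rightarrow> (nat \<Rightarrow> nat) set" where
  "slice m N k v = {i \<in> indices m N. i k = v}"

lemma finite_slice [simp, intro]: "finite (slice m N k v)"
  by (simp add: slice_def)

lemma sum_slices: "k < m \<Longrightarrow> (\<Sum>v<N. \<Sum>i\<in>slice m N k v. f i) = (\<Sum>i\<in>indices m N. f i)"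
  unfolding slice_def by (rule sum.group) (auto simp: indices_less)

lemma sum_slices_within:
  "l < m \<Longrightarrow> (\<Sum>w<N. \<Sum>i\<in>{i\<in>slice m N k v. i l = w}. f i) = (\<Sum>i\<in>slice m N k v. f i)"
  by (rule sum.group) (auto simp: slice_def indices_less)

text \<open>
  The case \<open>k = l\<close> comes first: it is the bound on the column sums which the case \<open>k \<noteq> l\<close> needs, where
  \<open>b\<close> is summed over all indices but \<open>i k\<close> and \<open>i l\<close>.
\<close>

lemma marginal_sums_step:
  assumes b: "\<And>i. i \<in> indices m N \<Longrightarrow> 0 \<le> b i" and D: "0 < D"
    and r: "0 < r" and lam: "0 < lam" "lam \<le> 2" "1 / lam = 1 / r - \<alpha>" and al: "0 < \<alpha>"
    and l: "l < m"
    and A: "\<And>u k. weights N u \<Longrightarrow> k < m \<Longrightarrow>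
      (\<Sum>v<N. (\<Sum>i\<in>slice m N k v. b i * u (i l) powr (2 * \<alpha>)) powr (r / 2)) \<le> D powr r"
    and k: "k < m"
  shows "(\<Sum>v<N. (\<Sum>i\<in>slice m N k v. b i) powr (lam / 2)) \<le> D powr lam"
proof -
  have b_slice: "0 \<le> b i" if "i \<in> slice m N k v" for i k v
    using that b by (simp add: slice_def)
  have same: "(\<Sum>v<N. (\<Sum>i\<in>slice m N l v. b i) powr (lam / 2)) \<le> D powr lam"
  proof (rule remove_weight_same_index[OF _ _ D r lam(1,3) al])
    fix u :: "nat \<Rightarrow> real"
    assume "\<And>j. j \<in> {..<N} \<Longrightarrow> 0 \<le> u j" "sum u {..<N} \<le> 1"
    then have "weights N u" by (simp add: weights_def)
    have "(\<Sum>i\<in>slice m N l v. b i) * u v powr (2 * \<alpha>)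
        = (\<Sum>i\<in>slice m N l v. b i * u (i l) powr (2 * \<alpha>))" for v
      unfolding sum_distrib_right by (intro sum.cong) (auto simp: slice_def)
    then show "(\<Sum>v<N. ((\<Sum>i\<in>slice m N l v. b i) * u v powr (2 * \<alpha>)) powr (r / 2)) \<le> D powr r"
      using A[OF \<open>weights N u\<close> l] by simp
  qed (auto intro: sum_nonneg b_slice)
  show ?thesis
  proof (cases "k = l")
    case False
    define c where "c v w = (\<Sum>i\<in>{i\<in>slice m N k v. i l = w}. b i)" for v w
    have c: "(\<Sum>w<N. c v w * x w) = (\<Sum>i\<in>slice m N k v. b i * x (i l))" for v x
    proof -
      have "c v w * x w = (\<Sum>i\<in>{i\<in>slice m N k v. i l = w}. b i * x (i l))" for w
        unfolding c_def sum_distrib_right by (intro sum.cong) auto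
      then show ?thesis
        using sum_slices_within[OF l, where f = "\<lambda>i. b i * x (i l)"] by simp
    qed
    have c1: "(\<Sum>w<N. c v w) = (\<Sum>i\<in>slice m N k v. b i)" for v
      using c[of v "\<lambda>_. 1"] by simp
    have c2: "(\<Sum>v<N. c v w) = (\<Sum>i\<in>slice m N l w. b i)" for w
    proof -
      have "{i \<in> slice m N k v. i l = w} = {i \<in> slice m N l w. i k = v}" for v
        by (auto simp: slice_def)
      then show ?thesis
        using sum_slices_within[OF k, where f = b] by (simp add: c_def)
    qed
    have "(\<Sum>v<N. (\<Sum>w<N. c v w) powr (lam / 2)) \<le> D powr lam"
    proof (rule remove_weight_other_index[OF _ _ _ D r lam al])
      show "0 \<le> c i j" for i j
        unfolding c_def by (rule sum_nonneg) (auto simp: slice_def b)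
      show "(\<Sum>j<N. (\<Sum>i<N. c i j) powr (lam / 2)) \<le> D powr lam"
        using same by (simp add: c2)
      show "(\<Sum>i<N. (\<Sum>j<N. c i j * u j powr (2 * \<alpha>)) powr (r / 2)) \<le> D powr r"
        if "\<And>j. j \<in> {..<N} \<Longrightarrow> 0 \<le> u j" "sum u {..<N} \<le> 1" for u
        unfolding c using that by (intro A k) (auto simp: weights_def)
    qed auto
    then show ?thesis by (simp add: c1)
  qed (use same in simp)
qed

text \<open>
  The weights of the factors are removed one after the other. Once those of the factors below \<open>l\<close>
  are gone, the exponent is \<open>1 / (1 - (\<Sum>j<l. \<alpha> j))\<close>, which stays at most \<open>2\<close>.
\<close>

lemma marginal_sums_bound:
  assumes b: "\<And>i. i \<in> indices m N \<Longrightarrow> 0 \<le> b i" and D: "0 < D"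
    and al: "\<And>j. j < m \<Longrightarrow> 0 \<le> \<alpha> j" and s: "(\<Sum>j<m. \<alpha> j) \<le> 1 / 2"
    and A: "\<And>u k. (\<And>j. j < m \<Longrightarrow> weights N (u j)) \<Longrightarrow> k < m \<Longrightarrow>
      (\<Sum>v<N. sqrt (\<Sum>i\<in>slice m N k v. b i * (\<Prod>j<m. wpow (u j (i j)) (2 * \<alpha> j)))) \<le> D"
    and k: "k < m"
    and lam: "lam = 1 / (1 - (\<Sum>j<m. \<alpha> j))"
  shows "(\<Sum>v<N. (\<Sum>i\<in>slice m N k v. b i) powr (lam / 2)) \<le> D powr lam"
proof -
  define r where "r l = 1 / (1 - (\<Sum>j<l. \<alpha> j))" for l
  have step: "(\<Sum>v<N. (\<Sum>i\<in>slice m N k v. b i * (\<Prod>j\<in>{l..<m}. wpow (u j (i j)) (2 * \<alpha> j))) powr (r l / 2))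
      \<le> D powr r l"
    if "l \<le> m" "\<And>j. j < m \<Longrightarrow> weights N (u j)" "k < m" for l u k
    using that
  proof (induction l arbitrary: u k)
    case 0
    have "0 \<le> (\<Sum>i\<in>slice m N k v. b i * (\<Prod>j<m. wpow (u j (i j)) (2 * \<alpha> j)))" for v
      by (intro sum_nonneg mult_nonneg_nonneg prod_nonneg) (auto simp: slice_def b)
    then show ?case
      using A[of u k] 0 D by (simp add: r_def atLeast0LessThan powr_half_sqrt)
  next
    case (Suc l)
    have l: "l < m" using Suc.prems by simp
    have split: "{l..<m} = insert l {Suc l..<m}" using l by auto
    define b' where "b' i = b i * (\<Prod>j\<in>{Suc l..<m}. wpow (u j (i j)) (2 * \<alpha> j))" for i
    have IH: "(\<Sum>v<N. (\<Sum>i\<in>slice m N k v. b' i * wpow (x (i l)) (2 * \<alpha> l)) powr (r l / 2)) \<le> D powr r l"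
      if "weights N x" "k < m" for x k
    proof -
      have "(\<Prod>j\<in>{Suc l..<m}. wpow ((u(l := x)) j (i j)) (2 * \<alpha> j)) = (\<Prod>j\<in>{Suc l..<m}. wpow (u j (i j)) (2 * \<alpha> j))" for i
        by (intro prod.cong) auto
      then show ?thesis
        using Suc.IH[of "u(l := x)" k] that Suc.prems by (simp add: split b'_def mult_ac)
    qed
    have part: "(\<Sum>j<l'. \<alpha> j) \<le> 1 / 2" if "l' \<le> m" for l'
    proof -
      have "(\<Sum>j<l'. \<alpha> j) \<le> (\<Sum>j<m. \<alpha> j)"
        using that al by (intro sum_mono2) auto
      then show ?thesis using s by simp
    qed
    have r_pos: "0 < r l" "0 < r (Suc l)" "r (Suc l) \<le> 2"
      using part[of l] part[of "Suc l"] l by (auto simp: r_def field_simps)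
    have r_Suc: "1 / r (Suc l) = 1 / r l - \<alpha> l"
      by (simp add: r_def)
    show ?case
    proof (cases "\<alpha> l = 0")
      case True
      then have "r (Suc l) = r l" by (simp add: r_def)
      then show ?thesis
        using IH[of "u l" k] Suc.prems l True by (simp add: b'_def wpow_def)
    next
      case False
      then have "\<alpha> l > 0" using al[OF l] by simp
      have "(\<Sum>v<N. (\<Sum>i\<in>slice m N k v. b' i) powr (r (Suc l) / 2)) \<le> D powr r (Suc l)"
      proof (rule marginal_sums_step[OF _ D r_pos(1,2,3) r_Suc \<open>\<alpha> l > 0\<close> l])
        show "0 \<le> b' i" if "i \<in> indices m N" for i
          using b[OF that] by (auto simp: b'_def intro!: mult_nonneg_nonneg prod_nonneg)
        show "(\<Sum>v<N. (\<Sum>i\<in>slice m N k v. b' i * x (i l) powr (2 * \<alpha> l)) powr (r l / 2)) \<le> D powr r l"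
          if "weights N x" "k < m" for x k
          using IH[OF that] False by (simp add: wpow_def)
      qed (use Suc.prems in auto)
      then show ?thesis by (simp add: b'_def)
    qed
  qed
  show ?thesis
    using step[of m "\<lambda>_ _. 0" k] k by (simp add: r_def lam weights_def)
qed

text \<open>
  Blei's inequality. Divide \<open>b i\<close> by the geometric mean of the
  powers \<open>1 - \<lambda> / 2\<close> of the marginals through \<open>i\<close>; by the inequality of arithmetic and geometric means
  the quotient has a sum of at most \<open>D powr \<lambda>\<close>. The product of the powers \<open>\<lambda> / 2\<close> of the marginals
  has a sum that factorises. Hoelder combines the two, and \<open>\<mu>\<close> is the exponent for which
  the marginals cancel.
\<close>

lemma Blei_inequality:
  assumes b: "\<And>i. i \<in> indices m N \<Longrightarrow> 0 \<le> b i" and D: "0 < D" and m: "1 \<le> m"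
    and lam: "0 < lam" "lam < 2"
    and mu: "1 / mu = 1 / (real m * lam) + (real m - 1) / (2 * real m)"
    and marg: "\<And>k. k < m \<Longrightarrow> (\<Sum>v<N. (\<Sum>i\<in>slice m N k v. b i) powr (lam / 2)) \<le> D powr lam"
  shows "(\<Sum>i\<in>indices m N. b i powr (mu / 2)) \<le> D powr mu"
proof -
  define \<delta> where "\<delta> = 1 - lam / 2"
  define \<tau> where "\<tau> = mu / 2"
  have del: "0 < \<delta>" "\<delta> < 1" using lam by (auto simp: \<delta>_def)
  have m0: "real m > 0" using m by simp
  have inv_tau: "1 / \<tau> = 1 + \<delta> * 2 / (lam * m)"
  proof -
    have "1 / \<tau> = 2 * (1 / mu)" by (simp add: \<tau>_def)
    then show ?thesis
      unfolding mu using lam m0 by (simp add: \<delta>_def field_simps)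
  qed
  have "1 / \<tau> > 1" using inv_tau del lam m0 by simp
  then have tau: "0 < \<tau>" "\<tau> < 1"
    by (auto simp: less_divide_eq_1)
  have cancel: "\<tau> * (\<delta> / m) = (1 - \<tau>) * (lam / 2)"
    using inv_tau tau lam m0 by (simp add: field_simps)
  have total: "lam * \<tau> + lam * m * (1 - \<tau>) = mu"
  proof -
    have "lam * \<tau> + lam * m * (1 - \<tau>) = lam * \<tau> + 2 * m * ((1 - \<tau>) * (lam / 2))" by simp
    also have "\<dots> = lam * \<tau> + 2 * (\<tau> * \<delta>)" unfolding cancel[symmetric] using m0 by simp
    finally show ?thesis by (simp add: \<delta>_def \<tau>_def algebra_simps)
  qed
  define B where "B k v = (\<Sum>i\<in>slice m N k v. b i)" for k v
  have B0: "B k v \<ge> 0" for k v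
    by (auto simp: B_def slice_def intro!: sum_nonneg b)
  have bB: "b i \<le> B k (i k)" if "i \<in> indices m N" for i k
    unfolding B_def using that b by (intro member_le_sum) (auto simp: slice_def)
  define X where "X i = b i * (\<Prod>k<m. B k (i k) powr (- (\<delta> / m)))" for i
  define Y where "Y i = (\<Prod>k<m. B k (i k) powr (lam / 2))" for i
  have X0: "X i \<ge> 0" if "i \<in> indices m N" for i
    using b[OF that] by (auto simp: X_def intro!: prod_nonneg mult_nonneg_nonneg)
  have Y0: "Y i \<ge> 0" for i
    by (auto simp: Y_def intro!: prod_nonneg)
  have XY: "b i powr \<tau> = X i powr \<tau> * Y i powr (1 - \<tau>)" if i: "i \<in> indices m N" for i
  proof (cases "b i = 0")
    case False
    then have pos: "b i > 0" "B k (i k) > 0" for k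
      using b[OF i] bB[OF i, of k] by auto
    have "X i powr \<tau> * Y i powr (1 - \<tau>)
        = b i powr \<tau> * (\<Prod>k<m. B k (i k) powr (- (\<delta> / m) * \<tau>) * B k (i k) powr (lam / 2 * (1 - \<tau>)))"
      by (simp only: X_def Y_def powr_mult powr_powr prod_powr_distrib prod.distrib mult.assoc)
    also have "(\<Prod>k<m. B k (i k) powr (- (\<delta> / m) * \<tau>) * B k (i k) powr (lam / 2 * (1 - \<tau>))) = 1"
    proof (intro prod.neutral ballI)
      fix k
      have "- (\<delta> / m) * \<tau> + lam / 2 * (1 - \<tau>) = 0"
        using cancel by (simp add: algebra_simps)
      then show "B k (i k) powr (- (\<delta> / m) * \<tau>) * B k (i k) powr (lam / 2 * (1 - \<tau>)) = 1"
        unfolding powr_add[symmetric] using pos(2)[of k] by simp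
    qed
    finally show ?thesis by simp
  qed (simp add: X_def)
  have sumX: "(\<Sum>i\<in>indices m N. X i) \<le> D powr lam"
  proof -
    have "X i \<le> (\<Sum>k<m. b i * B k (i k) powr (- \<delta>) / m)" if "i \<in> indices m N" for i
    proof -
      have "(\<Prod>k<m. B k (i k) powr (- (\<delta> / m))) = (\<Prod>k<m. B k (i k) powr (- \<delta>)) powr (1 / card {..<m})"
        by (simp add: prod_powr_distrib powr_powr)
      also have "\<dots> \<le> (\<Sum>k<m. B k (i k) powr (- \<delta>) / card {..<m})"
        using m by (intro arith_geom_mean) (auto simp: lessThan_empty_iff)
      finally show ?thesis
        using mult_left_mono[OF _ b[OF that]] by (fastforce simp: X_def sum_distrib_left)
    qed
    then have "(\<Sum>i\<in>indices m N. X i) \<le> (\<Sum>i\<in>indices m N. \<Sum>k<m. b i * B k (i k) powr (- \<delta>) / m)"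
      by (rule sum_mono)
    also have "\<dots> = (\<Sum>k<m. (\<Sum>i\<in>indices m N. b i * B k (i k) powr (- \<delta>)) / m)"
      by (subst sum.swap) (simp add: sum_divide_distrib)
    also have "\<dots> \<le> (\<Sum>k<m. D powr lam / m)"
    proof (intro sum_mono divide_right_mono)
      fix k assume "k \<in> {..<m}"
      then have k: "k < m" by simp
      have "(\<Sum>i\<in>indices m N. b i * B k (i k) powr (- \<delta>)) = (\<Sum>v<N. B k v * B k v powr (- \<delta>))"
        unfolding sum_slices[OF k, symmetric]
        by (intro sum.cong refl) (auto simp: B_def sum_distrib_right slice_def intro!: sum.cong)
      also have "\<dots> = (\<Sum>v<N. B k v powr (lam / 2))"
        using B0 by (simp add: powr_mult_base \<delta>_def)
      finally show "(\<Sum>i\<in>indices m N. b i * B k (i k) powr (- \<delta>)) \<le> D powr lam"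
        using marg[OF k] by (simp add: B_def)
    qed simp
    finally show ?thesis using m0 by simp
  qed
  have sumY: "(\<Sum>i\<in>indices m N. Y i) \<le> D powr (lam * m)"
  proof -
    have "(\<Sum>i\<in>indices m N. Y i) = (\<Prod>k<m. \<Sum>v<N. B k v powr (lam / 2))"
      unfolding Y_def by (rule sum_indices_prod)
    also have "\<dots> \<le> (\<Prod>k<m. D powr lam)"
      using marg by (intro prod_mono) (auto simp: B_def intro!: sum_nonneg)
    also have "\<dots> = D powr (lam * m)"
      using D by (simp add: powr_powr flip: powr_realpow)
    finally show ?thesis .
  qed
  have "(\<Sum>i\<in>indices m N. b i powr \<tau>) = (\<Sum>i\<in>indices m N. X i powr \<tau> * Y i powr (1 - \<tau>))"
    by (intro sum.cong refl XY)
  also have "\<dots> \<le> (\<Sum>i\<in>indices m N. X i) powr \<tau> * (\<Sum>i\<in>indices m N. Y i) powr (1 - \<tau>)"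
    using tau X0 Y0 by (intro Holder_sum_powr) auto
  also have "\<dots> \<le> (D powr lam) powr \<tau> * (D powr (lam * m)) powr (1 - \<tau>)"
    using sumX sumY X0 Y0 tau by (intro mult_mono powr_mono2) (auto intro: sum_nonneg)
  also have "\<dots> = D powr mu"
    by (simp only: powr_powr total flip: powr_add)
  finally show ?thesis by (simp add: \<tau>_def)
qed


section \<open>Coefficients of bounded finite forms\<close>

text \<open>
  A bound for the finite form with coefficients \<open>a\<close> on the product of the unit balls of the
  \<open>N\<close>-dimensional \<open>\<ell>\<^sub>p\<close>-spaces with \<open>1 / p = \<alpha> j\<close>.
\<close>

definition form_bound :: "nat \<Rightarrow> nat \<Rightarrow> (nat \<Rightarrow> real) \<Rightarrow> ((nat \<Rightarrow> nat) \<Rightarrow> complex) \<Rightarrow> real \<Rightarrow> bool" where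
  "form_bound m N \<alpha> a M \<longleftrightarrow> (\<forall>u x. (\<forall>j<m. weights N (u j)) \<longrightarrow>
     (\<forall>j<m. \<forall>n<N. cmod (x j n) \<le> wpow (u j n) (\<alpha> j)) \<longrightarrow>
     cmod (\<Sum>i\<in>indices m N. a i * (\<Prod>j<m. x j (i j))) \<le> M)"

lemma form_boundD:
  assumes "form_bound m N \<alpha> a M" "\<And>j. j < m \<Longrightarrow> weights N (u j)"
    "\<And>j n. j < m \<Longrightarrow> n < N \<Longrightarrow> cmod (x j n) \<le> wpow (u j n) (\<alpha> j)"
  shows "cmod (\<Sum>i\<in>indices m N. a i * (\<Prod>j<m. x j (i j))) \<le> M"
  using assms unfolding form_bound_def by blast

lemma norm_weighted_coeff:
  "(cmod (a i * (\<Prod>j<m. complex_of_real (wpow (u j (i j)) (\<alpha> j)))))\<^sup>2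
     = (cmod (a i))\<^sup>2 * (\<Prod>j<m. wpow (u j (i j)) (2 * \<alpha> j))"
proof -
  have "(cmod (\<Prod>j<m. complex_of_real (wpow (u j (i j)) (\<alpha> j))))\<^sup>2 = (\<Prod>j<m. wpow (u j (i j)) (2 * \<alpha> j))"
    by (simp add: prod_norm[symmetric] prod_power_distrib wpow_power2)
  then show ?thesis
    by (simp only: norm_mult power_mult_distrib)
qed

text \<open>
  Multiplying the variables by fixed vectors in the unit balls turns the form into one on
  \<open>\<ell>\<^sub>\<infinity>\<close>-spaces, to which the mixed inequality applies.
\<close>

lemma weighted_mixed_inequality:
  assumes bd: "form_bound m N \<alpha> a M" and u: "\<And>j. j < m \<Longrightarrow> weights N (u j)" and k: "k < m"
  shows "(\<Sum>v<N. sqrt (\<Sum>i\<in>slice m N k v. (cmod (a i))\<^sup>2 * (\<Prod>j<m. wpow (u j (i j)) (2 * \<alpha> j))))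
     \<le> sqrt 3 ^ m * M"
proof -
  define c where "c i = a i * (\<Prod>j<m. complex_of_real (wpow (u j (i j)) (\<alpha> j)))" for i
  have "(\<Sum>v<N. sqrt (\<Sum>i\<in>{i\<in>indices m N. i k = v}. (cmod (c i))\<^sup>2)) \<le> sqrt 3 ^ m * M"
  proof (rule mixed_1_2_inequality[OF _ k])
    fix x :: "nat \<Rightarrow> nat \<Rightarrow> complex"
    assume x: "\<And>j n. j < m \<Longrightarrow> n < N \<Longrightarrow> cmod (x j n) \<le> 1"
    have "cmod (\<Sum>i\<in>indices m N. a i * (\<Prod>j<m. complex_of_real (wpow (u j (i j)) (\<alpha> j)) * x j (i j))) \<le> M"
      using x by (intro form_boundD[OF bd u]) (auto simp: norm_mult mult_left_le)
    then show "cmod (\<Sum>i\<in>indices m N. c i * (\<Prod>j<m. x j (i j))) \<le> M"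
      by (simp add: c_def prod.distrib mult.assoc)
  qed
  then show ?thesis
    unfolding c_def norm_weighted_coeff slice_def .
qed

lemma form_bound_marginals:
  assumes bd: "form_bound m N \<alpha> a M" and M: "0 < M"
    and al: "\<And>j. j < m \<Longrightarrow> 0 \<le> \<alpha> j" and s: "(\<Sum>j<m. \<alpha> j) \<le> 1 / 2"
    and lam: "lam = 1 / (1 - (\<Sum>j<m. \<alpha> j))" and k: "k < m"
  shows "(\<Sum>v<N. (\<Sum>i\<in>slice m N k v. (cmod (a i))\<^sup>2) powr (lam / 2)) \<le> (sqrt 3 ^ m * M) powr lam"
  by (rule marginal_sums_bound[OF _ _ al s _ k lam])
     (use M in \<open>auto intro: weighted_mixed_inequality[OF bd]\<close>)

lemma coefficients_small_sum:
  assumes bd: "form_bound m N \<alpha> a M" and M: "0 < M" and m: "1 \<le> m"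
    and al: "\<And>j. j < m \<Longrightarrow> 0 \<le> \<alpha> j" and s: "(\<Sum>j<m. \<alpha> j) < 1 / 2"
    and lam: "1 / lam = 1 - (\<Sum>j<m. \<alpha> j)"
    and mu: "1 / mu = 1 / (real m * lam) + (real m - 1) / (2 * real m)"
  shows "(\<Sum>i\<in>indices m N. cmod (a i) powr mu) \<le> (sqrt 3 ^ m * M) powr mu"
proof -
  have lam': "lam = 1 / (1 - (\<Sum>j<m. \<alpha> j))"
    using lam by (metis divide_divide_eq_right div_by_1 mult_1)
  have lam2: "0 < lam" "lam < 2"
    using s unfolding lam' by (auto simp: field_simps)
  have "(\<Sum>i\<in>indices m N. ((cmod (a i))\<^sup>2) powr (mu / 2)) \<le> (sqrt 3 ^ m * M) powr mu"
    using M s by (intro Blei_inequality[OF _ _ m lam2 mu] form_bound_marginals[OF bd M al _ lam']) auto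
  moreover have "((cmod (a i))\<^sup>2) powr (mu / 2) = cmod (a i) powr mu" for i
    by (cases "a i = 0") (simp_all add: powr_powr flip: powr_numeral)
  ultimately show ?thesis by simp
qed

lemma wpow_product_le:
  assumes u: "0 \<le> u" "0 \<le> v" and th: "0 \<le> \<theta>" "\<theta> \<le> 1" and a: "0 \<le> a"
  shows "wpow u (\<theta> * a) * wpow v ((1 - \<theta>) * a) \<le> wpow (\<theta> * u + (1 - \<theta>) * v) a"
proof (cases "a = 0 \<or> \<theta> = 0 \<or> \<theta> = 1")
  case False
  then have "wpow u (\<theta> * a) * wpow v ((1 - \<theta>) * a) = (u powr \<theta> * v powr (1 - \<theta>)) powr a"
    by (simp add: wpow_def powr_mult powr_powr)
  also have "\<dots> \<le> (\<theta> * u + (1 - \<theta>) * v) powr a"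
    using Young_nonneg[of \<theta> "1 - \<theta>" u v] assms by (intro powr_mono2) auto
  finally show ?thesis using False by (simp add: wpow_def)
qed (auto simp: wpow_def)

lemma weights_convex:
  assumes "weights N u" "weights N v" "0 \<le> \<theta>" "\<theta> \<le> 1"
  shows "weights N (\<lambda>n. \<theta> * u n + (1 - \<theta>) * v n)"
proof -
  have "(\<Sum>n<N. \<theta> * u n + (1 - \<theta>) * v n) = \<theta> * (\<Sum>n<N. u n) + (1 - \<theta>) * (\<Sum>n<N. v n)"
    by (simp add: sum.distrib sum_distrib_left)
  also have "\<dots> \<le> \<theta> * 1 + (1 - \<theta>) * 1"
    using assms by (intro add_mono mult_left_mono) (auto simp: weights_def)
  finally show ?thesis using assms by (auto simp: weights_def)
qed

text \<open>
  Every exponent is split as \<open>\<alpha> j = \<theta> * \<alpha> j + (1 - \<theta>) * \<alpha> j\<close> such that the first parts add up to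
  \<open>1 / 2\<close>. For fixed weights \<open>u\<close> on the second parts the previous case, at its end point \<open>\<lambda> = 2\<close>,
  bounds the sum of \<open>\<bar>a i\<bar>\<^sup>2\<close> against those weights. Taking for \<open>u j\<close> the normalised
  marginals of \<open>\<bar>a i\<bar> powr \<lambda>\<close>, which are at least the single entries, yields the \<open>\<lambda>\<close>-sum back.
\<close>

lemma coefficients_large_sum:
  assumes bd: "form_bound m N \<alpha> a M" and M: "0 < M"
    and al: "\<And>j. j < m \<Longrightarrow> 0 \<le> \<alpha> j" and s: "1 / 2 \<le> (\<Sum>j<m. \<alpha> j)" "(\<Sum>j<m. \<alpha> j) < 1"
    and lam: "1 / lam = 1 - (\<Sum>j<m. \<alpha> j)"
  shows "(\<Sum>i\<in>indices m N. cmod (a i) powr lam) \<le> (sqrt 3 ^ m * M) powr lam"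
proof -
  define S where "S = (\<Sum>j<m. \<alpha> j)"
  define D where "D = sqrt 3 ^ m * M"
  have S: "1 / 2 \<le> S" "S < 1" using s by (auto simp: S_def)
  have D: "D > 0" using M by (simp add: D_def)
  have lamS: "1 / lam = 1 - S" using lam by (simp add: S_def)
  have lam0: "lam > 0"
    using lamS S by (metis diff_gt_0_iff_gt zero_less_divide_1_iff)
  have m: "0 < m"
    using S by (cases m) (auto simp: S_def)
  define \<theta> where "\<theta> = 1 / (2 * S)"
  have th: "0 \<le> \<theta>" "\<theta> \<le> 1" "\<theta> * S = 1 / 2"
    using S by (auto simp: \<theta>_def field_simps)
  have weighted: "(\<Sum>i\<in>indices m N. (cmod (a i))\<^sup>2 * (\<Prod>j<m. wpow (u j (i j)) (2 * ((1 - \<theta>) * \<alpha> j)))) \<le> D\<^sup>2"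
    if u: "\<And>j. j < m \<Longrightarrow> weights N (u j)" for u
  proof -
    define c where "c i = a i * (\<Prod>j<m. complex_of_real (wpow (u j (i j)) ((1 - \<theta>) * \<alpha> j)))" for i
    have bdc: "form_bound m N (\<lambda>j. \<theta> * \<alpha> j) c M"
      unfolding form_bound_def
    proof (intro allI impI)
      fix v x
      assume v: "\<forall>j<m. weights N (v j)" and x: "\<forall>j<m. \<forall>n<N. cmod (x j n) \<le> wpow (v j n) (\<theta> * \<alpha> j)"
      have "cmod (\<Sum>i\<in>indices m N. a i * (\<Prod>j<m. complex_of_real (wpow (u j (i j)) ((1 - \<theta>) * \<alpha> j)) * x j (i j))) \<le> M"
      proof (rule form_boundD[OF bd weights_convex[OF v[rule_format] u th(1,2)]])
        fix j n assume jn: "j < m" "n < N"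
        have "cmod (complex_of_real (wpow (u j n) ((1 - \<theta>) * \<alpha> j)) * x j n)
            \<le> wpow (v j n) (\<theta> * \<alpha> j) * wpow (u j n) ((1 - \<theta>) * \<alpha> j)"
          using x jn by (simp add: norm_mult mult.commute[of "wpow (u j n) _"] mult_right_mono)
        also have "\<dots> \<le> wpow (\<theta> * v j n + (1 - \<theta>) * u j n) (\<alpha> j)"
          using jn u v al th by (intro wpow_product_le) (auto intro: weights_nonneg)
        finally show "cmod (complex_of_real (wpow (u j n) ((1 - \<theta>) * \<alpha> j)) * x j n)
            \<le> wpow (\<theta> * v j n + (1 - \<theta>) * u j n) (\<alpha> j)" .
      qed auto
      then show "cmod (\<Sum>i\<in>indices m N. c i * (\<Prod>j<m. x j (i j))) \<le> M"
        by (simp add: c_def prod.distrib mult.assoc)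
    qed
    have half: "(\<Sum>j<m. \<theta> * \<alpha> j) = 1 / 2"
      using th by (simp add: S_def flip: sum_distrib_left)
    have "(\<Sum>v<N. (\<Sum>i\<in>slice m N 0 v. (cmod (c i))\<^sup>2) powr (2 / 2)) \<le> (sqrt 3 ^ m * M) powr 2"
      using M al th m
      by (intro form_bound_marginals[where \<alpha> = "\<lambda>j. \<theta> * \<alpha> j"] bdc; (subst half)?) simp_all
    then have "(\<Sum>i\<in>indices m N. (cmod (c i))\<^sup>2) \<le> D\<^sup>2"
      using M m by (simp add: sum_nonneg D_def sum_slices)
    then show ?thesis
      unfolding c_def norm_weighted_coeff[where \<alpha> = "\<lambda>j. (1 - \<theta>) * \<alpha> j"] .
  qed
  define L where "L = (\<Sum>i\<in>indices m N. cmod (a i) powr lam)"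
  have "L \<ge> 0" by (simp add: L_def sum_nonneg)
  show ?thesis
  proof (cases "L = 0")
    case False
    with \<open>L \<ge> 0\<close> have L: "L > 0" by simp
    define u where "u j v = (\<Sum>i\<in>slice m N j v. cmod (a i) powr lam) / L" for j v
    define \<sigma> where "\<sigma> = 2 * S - 1"
    have sig: "(\<Sum>j<m. 2 * ((1 - \<theta>) * \<alpha> j)) = \<sigma>"
    proof -
      have "(\<Sum>j<m. 2 * ((1 - \<theta>) * \<alpha> j)) = 2 * ((1 - \<theta>) * S)"
        by (simp add: S_def sum_distrib_left)
      then show ?thesis using th by (simp add: \<sigma>_def algebra_simps)
    qed
    have u: "weights N (u j)" if "j < m" for j
    proof -
      have "(\<Sum>v<N. u j v) = 1"
        unfolding u_def sum_divide_distrib[symmetric] sum_slices[OF that] L_def[symmetric]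
        using L by simp
      then show ?thesis
        using L by (auto simp: weights_def u_def intro!: divide_nonneg_pos sum_nonneg)
    qed
    have entry: "cmod (a i) powr lam * L powr (- \<sigma>)
        \<le> (cmod (a i))\<^sup>2 * (\<Prod>j<m. wpow (u j (i j)) (2 * ((1 - \<theta>) * \<alpha> j)))"
      if i: "i \<in> indices m N" for i
    proof (cases "a i = 0")
      case False
      define y where "y = cmod (a i) powr lam / L"
      have y: "y > 0" using False L by (simp add: y_def)
      have yu: "y \<le> u j (i j)" for j
        unfolding y_def u_def using L i
        by (intro divide_right_mono member_le_sum) (auto simp: slice_def)
      have e: "2 + lam * \<sigma> = lam"
        using lamS lam0 by (simp add: \<sigma>_def field_simps)
      have "cmod (a i) powr lam * L powr (- \<sigma>) = cmod (a i) powr 2 * y powr \<sigma>"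
        unfolding y_def powr_quotient_powr[OF L] mult.assoc[symmetric] powr_add[symmetric] e ..
      also have "\<dots> = (cmod (a i))\<^sup>2 * (\<Prod>j<m. y powr (2 * ((1 - \<theta>) * \<alpha> j)))"
        using y False by (simp add: powr_sum flip: sig)
      also have "\<dots> \<le> (cmod (a i))\<^sup>2 * (\<Prod>j<m. wpow (u j (i j)) (2 * ((1 - \<theta>) * \<alpha> j)))"
      proof (intro mult_left_mono prod_mono conjI)
        fix j assume "j \<in> {..<m}"
        then show "y powr (2 * ((1 - \<theta>) * \<alpha> j)) \<le> wpow (u j (i j)) (2 * ((1 - \<theta>) * \<alpha> j))"
          unfolding wpow_def using y yu[of j] al th by (auto intro!: powr_mono2)
      qed auto
      finally show ?thesis .
    qed (use lam0 in \<open>auto intro!: prod_nonneg\<close>)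
    have "L * L powr (- \<sigma>) \<le> (\<Sum>i\<in>indices m N. (cmod (a i))\<^sup>2 * (\<Prod>j<m. wpow (u j (i j)) (2 * ((1 - \<theta>) * \<alpha> j))))"
      unfolding L_def[symmetric] using sum_mono[OF entry] by (simp add: L_def sum_distrib_right)
    also have "\<dots> \<le> D\<^sup>2" by (rule weighted[OF u])
    finally have "L powr (1 + - \<sigma>) \<le> D powr 2"
      using L D powr_mult_base[of L "- \<sigma>"] by simp
    then have "(L powr (1 + - \<sigma>)) powr (lam / 2) \<le> (D powr 2) powr (lam / 2)"
      using lam0 by (intro powr_mono2) auto
    moreover have "(1 + - \<sigma>) * (lam / 2) = 1"
      using lamS lam0 by (simp add: \<sigma>_def field_simps)
    ultimately show ?thesis
      using L by (simp add: powr_powr L_def D_def)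
  qed (simp add: L_def)
qed

section \<open>Continuous forms and finite forms\<close>

lemma recip_exponent_cases:
  fixes q :: ennreal
  assumes "1 \<le> q"
  obtains (infinite) "q = \<infinity>" "enn2real (1 / q) = 0"
  | (finite) "q \<noteq> \<infinity>" "1 \<le> enn2real q" "enn2real (1 / q) = 1 / enn2real q"
proof (cases q)
  case (real r)
  then have r: "r \<ge> 1" using assms by (metis ennreal_1 ennreal_le_iff)
  then have "1 / q = ennreal (1 / r)"
    using real by (simp add: divide_ennreal flip: ennreal_1)
  then show thesis using r real by (intro finite) auto
next
  case top
  then show thesis by (intro infinite) auto
qed

lemma ell_finite_support:
  assumes "\<And>n. N \<le> n \<Longrightarrow> x n = 0"
  shows "x \<in> ell p"
proof -
  have sub: "range x \<subseteq> insert 0 (x ` {..<N})"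
    using assms by (auto simp: not_less) (metis image_eqI lessThan_iff not_le)
  have "bounded (range x)"
    by (rule bounded_subset[OF finite_imp_bounded sub]) auto
  moreover have "summable (\<lambda>n. cmod (x n) powr enn2real p)"
    using assms by (intro summable_finite[of "{..<N}"]) (auto simp: not_less)
  ultimately show ?thesis by (simp add: ell_def)
qed

lemma ell_norm_le_1_if_weights:
  assumes p: "1 \<le> p" and supp: "\<And>n. N \<le> n \<Longrightarrow> x n = 0" and u: "weights N u"
    and x: "\<And>n. n < N \<Longrightarrow> cmod (x n) \<le> wpow (u n) (enn2real (1 / p))"
  shows "ell_norm p x \<le> 1"
  using p
proof (cases rule: recip_exponent_cases)
  case infinite
  have "cmod (x n) \<le> 1" for n
    using x[of n] supp[of n] infinite by (cases "n < N") (auto simp: wpow_def)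
  then have "(SUP n. cmod (x n)) \<le> 1" by (intro cSUP_least) auto
  then show ?thesis by (simp add: ell_norm_def infinite)
next
  case finite
  define r where "r = enn2real p"
  have r: "r \<ge> 1" using finite by (simp add: r_def)
  have "(\<Sum>n. cmod (x n) powr r) = (\<Sum>n<N. cmod (x n) powr r)"
    using supp by (intro suminf_finite) (auto simp: not_less)
  also have "\<dots> \<le> (\<Sum>n<N. u n)"
  proof (intro sum_mono)
    fix n assume n: "n \<in> {..<N}"
    have "cmod (x n) powr r \<le> (u n powr (1 / r)) powr r"
      using x[of n] n r finite by (intro powr_mono2) (auto simp: wpow_def r_def split: if_splits)
    then show "cmod (x n) powr r \<le> u n"
      using r weights_nonneg[OF u, of n] n by (simp add: powr_powr)
  qed
  also have "\<dots> \<le> 1" using u by (simp add: weights_def)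
  finally have "(\<Sum>n. cmod (x n) powr r) \<le> 1" .
  moreover have "0 \<le> (\<Sum>n. cmod (x n) powr r)"
    by (intro suminf_nonneg summable_finite[of "{..<N}"]) (auto simp: supp not_less)
  ultimately have "(\<Sum>n. cmod (x n) powr r) powr (1 / r) \<le> 1"
    using r by (intro powr_le1) auto
  then show ?thesis using finite by (simp add: ell_norm_def r_def)
qed

lemma weights_if_ell_norm_less_1:
  assumes p: "1 \<le> p" and x: "x \<in> ell p" "ell_norm p x < 1"
  shows "\<exists>u. weights N u \<and> (\<forall>n<N. cmod (x n) \<le> wpow (u n) (enn2real (1 / p)))"
  using p
proof (cases rule: recip_exponent_cases)
  case infinite
  have "bdd_above (range (\<lambda>n. cmod (x n)))"
    using x infinite by (auto simp: ell_def bounded_iff bdd_above_def)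
  then have "cmod (x n) \<le> ell_norm p x" for n
    using x infinite by (auto simp: ell_norm_def intro: cSUP_upper)
  then have "cmod (x n) \<le> 1" for n
    using x(2) by (meson less_imp_le order_trans)
  then show ?thesis
    by (intro exI[of _ "\<lambda>_. 0"]) (auto simp: weights_def wpow_def infinite)
next
  case finite
  define r where "r = enn2real p"
  have r: "r \<ge> 1" using finite by (simp add: r_def)
  have sm: "summable (\<lambda>n. cmod (x n) powr r)"
    using x finite by (simp add: ell_def r_def)
  then have S: "(\<Sum>n<N. cmod (x n) powr r) \<le> (\<Sum>n. cmod (x n) powr r)" "0 \<le> (\<Sum>n. cmod (x n) powr r)"
    by (auto intro!: sum_le_suminf suminf_nonneg)
  have "(\<Sum>n. cmod (x n) powr r) powr (1 / r) < 1"
    using x finite by (simp add: ell_norm_def r_def)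
  then have "(\<Sum>n. cmod (x n) powr r) \<le> 1"
    using r S(2) by (meson ge_one_powr_ge_zero less_le_not_le linear divide_nonneg_nonneg zero_le_one order_trans)
  then have "weights N (\<lambda>n. cmod (x n) powr r)"
    using S by (simp add: weights_def)
  moreover have "cmod (x n) \<le> wpow (cmod (x n) powr r) (enn2real (1 / p))" for n
    using r finite by (simp add: wpow_def powr_powr r_def)
  ultimately show ?thesis by blast
qed

lemma ell_scale: "x \<in> ell p \<Longrightarrow> (\<lambda>n. c * x n) \<in> ell p"
  by (auto simp: ell_def norm_mult powr_mult bounded_iff intro!: summable_mult)
     (metis mult_left_mono norm_ge_zero)

lemma ell_norm_scale_le:
  assumes p: "1 \<le> p" and x: "x \<in> ell p"
  shows "ell_norm p (\<lambda>n. c * x n) \<le> cmod c * ell_norm p x"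
  using p
proof (cases rule: recip_exponent_cases)
  case infinite
  have bdd: "bdd_above (range (\<lambda>n. cmod (x n)))"
    using x infinite by (auto simp: ell_def bounded_iff bdd_above_def)
  have "(SUP n. cmod (c * x n)) \<le> cmod c * (SUP n. cmod (x n))"
    by (intro cSUP_least) (auto simp: norm_mult intro!: mult_left_mono cSUP_upper[OF _ bdd])
  then show ?thesis using infinite x ell_scale[OF x, of c] by (simp add: ell_norm_def)
next
  case finite
  have "summable (\<lambda>n. cmod (x n) powr enn2real p)" using x finite by (simp add: ell_def)
  then show ?thesis
    using finite x ell_scale[OF x, of c]
    by (simp add: ell_norm_def norm_mult powr_mult suminf_mult powr_powr)
qed

lemma zero_in_ell [simp]: "(\<lambda>n. 0) \<in> ell p"
  by (rule ell_finite_support[of 0]) simp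

lemma ell_norm_zero: "1 \<le> p \<Longrightarrow> ell_norm p (\<lambda>n. 0) = 0"
  by (simp add: ell_norm_eq_0)

lemma multilinear_upd:
  assumes T: "multilinear_form m p T" and x: "x \<in> ell_prod m p" and k: "k < m"
    and u: "u \<in> ell (p k)" and v: "v \<in> ell (p k)"
  shows "T (x(k := (\<lambda>n. a * u n + b * v n))) = a * T (x(k := u)) + b * T (x(k := v))"
  using assms unfolding multilinear_form_def by blast

lemma restrict_in_ell_prod:
  "(\<And>j. j < m \<Longrightarrow> f j \<in> ell (p j)) \<Longrightarrow> (\<lambda>j\<in>{..<m}. f j) \<in> ell_prod m p"
  by (auto simp: ell_prod_def)

lemma multilinear_scale:
  assumes T: "multilinear_form m p T" and x: "x \<in> ell_prod m p"
  shows "T (\<lambda>j\<in>{..<m}. \<lambda>n. c * x j n) = c ^ m * T x"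
proof -
  have xj: "x j \<in> ell (p j)" if "j < m" for j
    using x that by (auto simp: ell_prod_def)
  have "T (\<lambda>j\<in>{..<m}. if j < l then (\<lambda>n. c * x j n) else x j) = c ^ l * T x" if "l \<le> m" for l
    using that
  proof (induction l)
    case 0
    have "(\<lambda>j\<in>{..<m}. if j < 0 then (\<lambda>n. c * x j n) else x j) = x"
      using x by (auto simp: ell_prod_def PiE_def extensional_def fun_eq_iff)
    then show ?case by simp
  next
    case (Suc l)
    define z where "z = (\<lambda>j\<in>{..<m}. if j < l then (\<lambda>n. c * x j n) else x j)"
    have z: "z \<in> ell_prod m p"
      unfolding z_def using xj ell_scale by (intro restrict_in_ell_prod) auto
    have zl: "z(l := x l) = z" using Suc.prems by (auto simp: z_def)
    have "(\<lambda>j\<in>{..<m}. if j < Suc l then (\<lambda>n. c * x j n) else x j)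
        = z(l := (\<lambda>n. c * x l n + 0 * x l n))"
      using Suc.prems by (auto simp: z_def fun_eq_iff less_Suc_eq)
    then have step: "T (\<lambda>j\<in>{..<m}. if j < Suc l then (\<lambda>n. c * x j n) else x j) = c * T z"
      using multilinear_upd[OF T z, of l "x l" "x l" c 0] Suc.prems xj zl by simp
    have "T z = c ^ l * T x"
      unfolding z_def by (rule Suc.IH) (use Suc.prems in simp)
    then show ?case unfolding step power_Suc mult.assoc by (rule arg_cong)
  qed
  from this[of m] have "T (\<lambda>j\<in>{..<m}. if j < m then (\<lambda>n. c * x j n) else x j) = c ^ m * T x" by simp
  moreover have "(\<lambda>j\<in>{..<m}. if j < m then (\<lambda>n. c * x j n) else x j) = (\<lambda>j\<in>{..<m}. \<lambda>n. c * x j n)"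
    by (auto simp: fun_eq_iff)
  ultimately show ?thesis by simp
qed

lemma topspace_ell_topology: "1 \<le> p \<Longrightarrow> topspace (ell_topology p) = ell p"
  unfolding ell_topology_def by (simp add: Metric_space.topspace_mtopology[OF Metric_space_ell])

text \<open>
  A neighbourhood of the origin on which the form is bounded contains a product of balls, and
  multilinearity scales the bound to the product of the unit balls.
\<close>

lemma cont_multilinear_bounded:
  assumes p: "\<And>j. j < m \<Longrightarrow> 1 \<le> p j" and T: "cont_multilinear_form m p T"
  obtains K where "\<And>x. x \<in> ell_prod m p \<Longrightarrow> (\<And>j. j < m \<Longrightarrow> ell_norm (p j) (x j) < 1) \<Longrightarrow> cmod (T x) \<le> K"
proof -
  let ?X = "product_topology (\<lambda>j. ell_topology (p j)) {..<m}"
  let ?z = "\<lambda>j\<in>{..<m}. \<lambda>n. 0 :: complex"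
  have ml: "multilinear_form m p T" and ct: "continuous_map ?X euclidean T"
    using T by (auto simp: cont_multilinear_form_def)
  have top: "topspace ?X = ell_prod m p"
    unfolding topspace_product_topology ell_prod_def
    using p by (intro PiE_cong) (simp add: topspace_ell_topology)
  define S where "S = {x \<in> topspace ?X. T x \<in> ball 0 (cmod (T ?z) + 1)}"
  have "openin ?X S"
    unfolding S_def by (rule openin_continuous_map_preimage[OF ct]) simp
  moreover have "?z \<in> S"
    unfolding S_def top by (auto intro!: restrict_in_ell_prod)
  ultimately obtain U where U: "\<And>j. j \<in> {..<m} \<Longrightarrow> openin (ell_topology (p j)) (U j)"
    "?z \<in> PiE {..<m} U" "PiE {..<m} U \<subseteq> S"
    unfolding openin_product_topology_alt by (metis (no_types, lifting))
  have "\<exists>r>0. \<forall>y\<in>ell (p j). ell_norm (p j) y < r \<longrightarrow> y \<in> U j" if j: "j < m" for j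
  proof -
    interpret Metric_space "ell (p j)" "ell_dist (p j)"
      by (rule Metric_space_ell[OF p[OF j]])
    have "openin mtopology (U j)" using U(1) j by (simp add: ell_topology_def)
    moreover have "(\<lambda>n. 0) \<in> U j" using U(2) j by (auto dest: PiE_mem)
    ultimately obtain r where r: "r > 0" "mball (\<lambda>n. 0) r \<subseteq> U j"
      by (auto simp: openin_mtopology)
    have "y \<in> U j" if "y \<in> ell (p j)" "ell_norm (p j) y < r" for y
      using that r(2) by (auto simp: mball_def ell_dist_def ell_norm_minus)
    then show ?thesis using r by blast
  qed
  then obtain r where r: "\<And>j. j < m \<Longrightarrow> r j > 0"
    "\<And>j y. j < m \<Longrightarrow> y \<in> ell (p j) \<Longrightarrow> ell_norm (p j) y < r j \<Longrightarrow> y \<in> U j"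
    by metis
  define \<delta> where "\<delta> = Min (insert 1 (r ` {..<m}))"
  have del: "\<delta> > 0" "\<And>j. j < m \<Longrightarrow> \<delta> \<le> r j"
    using r(1) by (auto simp: \<delta>_def)
  show thesis
  proof
    fix x assume x: "x \<in> ell_prod m p" and norm: "\<And>j. j < m \<Longrightarrow> ell_norm (p j) (x j) < 1"
    have xj: "x j \<in> ell (p j)" if "j < m" for j
      using x that by (auto simp: ell_prod_def)
    have "(\<lambda>n. complex_of_real \<delta> * x j n) \<in> U j" if j: "j < m" for j
    proof (rule r(2)[OF j ell_scale[OF xj[OF j]]])
      have "ell_norm (p j) (\<lambda>n. complex_of_real \<delta> * x j n) \<le> \<delta> * ell_norm (p j) (x j)"
        using ell_norm_scale_le[OF p[OF j] xj[OF j], of "complex_of_real \<delta>"] del by simp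
      also have "\<dots> < \<delta> * 1"
        using norm[OF j] del by (intro mult_strict_left_mono) auto
      also have "\<dots> \<le> r j" using del j by simp
      finally show "ell_norm (p j) (\<lambda>n. complex_of_real \<delta> * x j n) < r j" .
    qed
    then have "(\<lambda>j\<in>{..<m}. \<lambda>n. complex_of_real \<delta> * x j n) \<in> S"
      using U(3) by (intro subsetD[OF U(3)]) auto
    then have "cmod (complex_of_real \<delta> ^ m * T x) < cmod (T ?z) + 1"
      by (simp add: S_def multilinear_scale[OF ml x])
    then show "cmod (T x) \<le> (cmod (T ?z) + 1) / \<delta> ^ m"
      using del by (simp add: norm_mult norm_power field_simps)
  qed
qed

lemma norm_le_form_norm:
  assumes p: "\<And>j. j < m \<Longrightarrow> 1 \<le> p j" and T: "cont_multilinear_form m p T"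
    and x: "x \<in> ell_prod m p" "\<And>j. j < m \<Longrightarrow> ell_norm (p j) (x j) < 1"
  shows "cmod (T x) \<le> form_norm m p T"
proof -
  obtain K where "\<And>x. x \<in> ell_prod m p \<Longrightarrow> (\<And>j. j < m \<Longrightarrow> ell_norm (p j) (x j) < 1) \<Longrightarrow> cmod (T x) \<le> K"
    using cont_multilinear_bounded[OF p T] by blast
  then show ?thesis
    unfolding form_norm_def using x by (intro cSUP_upper bdd_aboveI2[of _ _ K]) auto
qed

lemma zero_in_unit_balls:
  assumes "\<And>j. j < m \<Longrightarrow> 1 \<le> p j"
  shows "(\<lambda>j\<in>{..<m}. \<lambda>n. 0) \<in> {x \<in> ell_prod m p. \<forall>j<m. ell_norm (p j) (x j) < 1}"
  using assms by (auto intro!: restrict_in_ell_prod simp: ell_norm_zero)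

lemma form_norm_nonneg:
  assumes p: "\<And>j. j < m \<Longrightarrow> 1 \<le> p j" and T: "cont_multilinear_form m p T"
  shows "0 \<le> form_norm m p T"
proof -
  let ?z = "\<lambda>j\<in>{..<m}. \<lambda>n. 0 :: complex"
  have z: "?z \<in> {x \<in> ell_prod m p. \<forall>j<m. ell_norm (p j) (x j) < 1}"
    by (rule zero_in_unit_balls[OF p])
  have "cmod (T ?z) \<le> form_norm m p T"
    by (rule norm_le_form_norm[OF p T]) (use z in blast)+
  then show ?thesis using norm_ge_zero order_trans by blast
qed

definition truncate :: "nat \<Rightarrow> (nat \<Rightarrow> complex) \<Rightarrow> nat \<Rightarrow> complex" where
  "truncate N x = (\<lambda>n. if n < N then x n else 0)"

lemma truncate_in_ell [simp]: "truncate N x \<in> ell p"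
  by (rule ell_finite_support[of N]) (simp add: truncate_def)

lemma unit_seq_in_ell [simp]: "unit_seq i \<in> ell p"
  by (rule ell_finite_support[of "Suc i"]) (simp add: unit_seq_def)

lemma multilinear_truncate_one:
  assumes T: "multilinear_form m p T" and z: "z \<in> ell_prod m p" and k: "k < m"
  shows "T (z(k := truncate N x)) = (\<Sum>n<N. x n * T (z(k := unit_seq n)))"
proof (induction N)
  case 0
  have "truncate 0 x = (\<lambda>n. 0 * truncate 0 x n + 0 * truncate 0 x n)"
    by (simp add: truncate_def)
  then have "T (z(k := truncate 0 x)) = T (z(k := (\<lambda>n. 0 * truncate 0 x n + 0 * truncate 0 x n)))"
    by (rule arg_cong)
  also have "\<dots> = 0 * T (z(k := truncate 0 x)) + 0 * T (z(k := truncate 0 x))"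
    by (rule multilinear_upd[OF T z k truncate_in_ell truncate_in_ell])
  finally have *: "T (z(k := truncate 0 x)) = 0"
    by (simp only: mult_zero_left add_0_left)
  show ?case unfolding * by simp
next
  case (Suc N)
  have "truncate (Suc N) x = (\<lambda>n. 1 * truncate N x n + x N * unit_seq N n)"
    by (auto simp: truncate_def unit_seq_def fun_eq_iff less_Suc_eq)
  then have "T (z(k := truncate (Suc N) x)) = T (z(k := (\<lambda>n. 1 * truncate N x n + x N * unit_seq N n)))"
    by (rule arg_cong)
  also have "\<dots> = 1 * T (z(k := truncate N x)) + x N * T (z(k := unit_seq N))"
    by (rule multilinear_upd[OF T z k truncate_in_ell unit_seq_in_ell])
  finally show ?case unfolding Suc.IH mult_1_left sum.lessThan_Suc .
qed

text \<open>
  The factors are expanded one after the other: in the intermediate sums the first \<open>l\<close> of them are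
  unit vectors and the others are still truncated vectors.
\<close>

lemma multilinear_truncate:
  assumes T: "multilinear_form m p T"
  shows "T (\<lambda>j\<in>{..<m}. truncate N (x j)) = (\<Sum>i\<in>indices m N. form_coeff m T i * (\<Prod>j<m. x j (i j)))"
proof -
  have "T (\<lambda>j\<in>{..<m}. truncate N (x j))
      = (\<Sum>i\<in>indices l N. T (\<lambda>j\<in>{..<m}. if j < l then unit_seq (i j) else truncate N (x j)) * (\<Prod>j<l. x j (i j)))"
    if "l \<le> m" for l
    using that
  proof (induction l)
    case 0
    then show ?case by (simp add: indices_0)
  next
    case (Suc l)
    have l: "l < m" using Suc.prems by simp
    have "T (\<lambda>j\<in>{..<m}. if j < l then unit_seq (i j) else truncate N (x j))
        = (\<Sum>v<N. x l v * T (\<lambda>j\<in>{..<m}. if j < Suc l then unit_seq ((i(l := v)) j) else truncate N (x j)))" for i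
    proof -
      let ?z = "\<lambda>j\<in>{..<m}. if j < l then unit_seq (i j) else truncate N (x j)"
      have "?z(l := truncate N (x l)) = ?z" using l by auto
      moreover have "?z(l := unit_seq v)
          = (\<lambda>j\<in>{..<m}. if j < Suc l then unit_seq ((i(l := v)) j) else truncate N (x j))" for v
        using l by (auto simp: fun_eq_iff less_Suc_eq)
      moreover have "?z \<in> ell_prod m p" by (rule restrict_in_ell_prod) simp
      note multilinear_truncate_one[OF T this l, of N "x l"]
      ultimately show ?thesis by (simp only:)
    qed
    note expand = this
    have "T (\<lambda>j\<in>{..<m}. truncate N (x j))
        = (\<Sum>i\<in>indices l N. T (\<lambda>j\<in>{..<m}. if j < l then unit_seq (i j) else truncate N (x j))
            * (\<Prod>j<l. x j (i j)))"
      by (rule Suc.IH) (use l in simp)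
    also have "\<dots> = (\<Sum>i\<in>indices l N. \<Sum>v<N.
        x l v * T (\<lambda>j\<in>{..<m}. if j < Suc l then unit_seq ((i(l := v)) j) else truncate N (x j))
            * (\<Prod>j<l. x j (i j)))"
      by (simp only: expand sum_distrib_right)
    also have "\<dots> = (\<Sum>i\<in>indices (Suc l) N. T (\<lambda>j\<in>{..<m}. if j < Suc l then unit_seq (i j) else truncate N (x j))
            * (\<Prod>j<Suc l. x j (i j)))"
      unfolding sum_indices_Suc by (subst sum.swap) (intro sum.cong refl, simp add: mult_ac)
    finally show ?case .
  qed
  from this[of m] show ?thesis
    by (auto simp: form_coeff_def restrict_def cong: if_cong intro!: sum.cong)
qed

text \<open>
  The factor \<open>2 ^ m\<close> is due to the strict inequalities in the definition of the norm: halving the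
  vectors moves them from the closed to the open unit balls.
\<close>

lemma form_bound_coeff:
  assumes p: "\<And>j. j < m \<Longrightarrow> 1 \<le> p j" and T: "cont_multilinear_form m p T"
  shows "form_bound m N (\<lambda>j. enn2real (1 / p j)) (form_coeff m T) (2 ^ m * form_norm m p T)"
  unfolding form_bound_def
proof (intro allI impI)
  fix u and x :: "nat \<Rightarrow> nat \<Rightarrow> complex"
  assume u: "\<forall>j<m. weights N (u j)" and x: "\<forall>j<m. \<forall>n<N. cmod (x j n) \<le> wpow (u j n) (enn2real (1 / p j))"
  have ml: "multilinear_form m p T" using T by (simp add: cont_multilinear_form_def)
  define y where "y = (\<lambda>j\<in>{..<m}. truncate N (x j))"
  have y: "y \<in> ell_prod m p" by (auto simp: y_def intro!: restrict_in_ell_prod)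
  have yn: "ell_norm (p j) (y j) \<le> 1" if "j < m" for j
    using that u x p by (intro ell_norm_le_1_if_weights[where u = "u j" and N = N]) (auto simp: y_def truncate_def)
  have "cmod (T (\<lambda>j\<in>{..<m}. \<lambda>n. (1 / 2) * y j n)) \<le> form_norm m p T"
  proof (rule norm_le_form_norm[OF p T])
    show "(\<lambda>j\<in>{..<m}. \<lambda>n. (1 / 2) * y j n) \<in> ell_prod m p"
      using y by (intro restrict_in_ell_prod ell_scale) (auto simp: ell_prod_def)
    fix j assume j: "j < m"
    have "ell_norm (p j) (\<lambda>n. (1 / 2) * y j n) \<le> cmod (1 / 2) * ell_norm (p j) (y j)"
      using j y by (intro ell_norm_scale_le p) (auto simp: ell_prod_def)
    then show "ell_norm (p j) ((\<lambda>j\<in>{..<m}. \<lambda>n. (1 / 2) * y j n) j) < 1"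
      using yn[OF j] j by simp
  qed
  then have "cmod ((1 / 2) ^ m * T y) \<le> form_norm m p T"
    by (simp only: multilinear_scale[OF ml y])
  then have "cmod (T y) \<le> 2 ^ m * form_norm m p T"
    by (simp add: norm_mult norm_power norm_divide power_divide field_simps)
  then show "cmod (\<Sum>i\<in>indices m N. form_coeff m T i * (\<Prod>j<m. x j (i j))) \<le> 2 ^ m * form_norm m p T"
    by (simp add: y_def multilinear_truncate[OF ml])
qed

lemma form_bound_mono:
  assumes "form_bound m N \<alpha> a M" "M \<le> M'"
  shows "form_bound m N \<alpha> a M'"
  unfolding form_bound_def
proof (intro allI impI)
  fix u x
  assume "\<forall>j<m. weights N (u j)" "\<forall>j<m. \<forall>n<N. cmod (x j n) \<le> wpow (u j n) (\<alpha> j)"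
  then have "cmod (\<Sum>i\<in>indices m N. a i * (\<Prod>j<m. x j (i j))) \<le> M"
    by (intro form_boundD[OF assms(1)]) auto
  then show "cmod (\<Sum>i\<in>indices m N. a i * (\<Prod>j<m. x j (i j))) \<le> M'"
    using assms(2) by simp
qed

lemma finite_subset_indices:
  assumes "finite F" "F \<subseteq> (\<Pi>\<^sub>E j\<in>{..<m}. UNIV)"
  obtains N where "F \<subseteq> indices m N"
proof -
  define N where "N = Suc (Max (insert 0 (\<Union>i\<in>F. i ` {..<m})))"
  have "i j < N" if "i \<in> F" "j < m" for i j
  proof -
    have "i j \<le> Max (insert 0 (\<Union>i\<in>F. i ` {..<m}))"
      by (rule Max_ge) (use assms that in auto)
    then show ?thesis by (simp add: N_def)
  qed
  then have "F \<subseteq> indices m N"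
    using assms by (auto simp: indices_def PiE_def)
  then show thesis using that by blast
qed

lemma indices_subset_PiE: "indices m N \<subseteq> (\<Pi>\<^sub>E j\<in>{..<m}. UNIV)"
  by (auto simp: indices_def PiE_def)

text \<open>
  The finite estimates are applied with \<open>M\<close> slightly larger than \<open>2 ^ m\<close> times the norm of the form,
  because that norm may vanish.
\<close>

lemma coeff_bound_if_form_bounds:
  assumes p: "\<And>j. j < m \<Longrightarrow> 1 \<le> p j" and t: "0 < t" and K: "0 \<le> K"
    and fin: "\<And>N a M. form_bound m N (\<lambda>j. enn2real (1 / p j)) a M \<Longrightarrow> 0 < M \<Longrightarrow>
      (\<Sum>i\<in>indices m N. cmod (a i) powr t) \<le> (K * M) powr t"
  shows "coeff_bound m p t (K * 2 ^ m)"
  unfolding coeff_bound_def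
proof (intro allI impI conjI)
  fix T assume T: "cont_multilinear_form m p T"
  let ?P = "\<Pi>\<^sub>E j\<in>{..<m}. (UNIV :: nat set)"
  let ?f = "\<lambda>i. cmod (form_coeff m T i) powr t"
  define R where "R = form_norm m p T"
  have R: "R \<ge> 0" using form_norm_nonneg[OF p T] by (simp add: R_def)
  have bound: "sum ?f F \<le> (K * M) powr t" if F: "finite F" "F \<subseteq> ?P" and M: "2 ^ m * R < M" for F M
  proof -
    have M0: "0 < M" using R M by (meson le_less_trans mult_nonneg_nonneg zero_le_numeral zero_le_power)
    obtain N where "F \<subseteq> indices m N" using finite_subset_indices[OF F] .
    then have "sum ?f F \<le> (\<Sum>i\<in>indices m N. ?f i)" by (intro sum_mono2) auto
    also have "\<dots> \<le> (K * M) powr t"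
      using M by (intro fin M0 form_bound_mono[OF form_bound_coeff[OF p T]]) (auto simp: R_def)
    finally show ?thesis .
  qed
  show summ: "?f summable_on ?P"
    using bound[where M = "2 ^ m * R + 1"]
    by (intro nonneg_bdd_above_summable_on bdd_aboveI2[where M = "(K * (2 ^ m * R + 1)) powr t"]) auto
  have "(\<Sum>\<^sub>\<infinity>i\<in>?P. ?f i) powr (1 / t) \<le> K * 2 ^ m * R + e" if e: "e > 0" for e
  proof -
    define d where "d = e / (K + 1)"
    have d: "d > 0" using e K by (simp add: d_def)
    have "(\<Sum>\<^sub>\<infinity>i\<in>?P. ?f i) \<le> (K * (2 ^ m * R + d)) powr t"
      using d by (intro infsum_le_finite_sums summ bound) auto
    then have "(\<Sum>\<^sub>\<infinity>i\<in>?P. ?f i) powr (1 / t) \<le> ((K * (2 ^ m * R + d)) powr t) powr (1 / t)"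
      using t by (intro powr_mono2 infsum_nonneg) auto
    also have "\<dots> = K * 2 ^ m * R + K * d"
      using t K R d by (simp add: powr_powr algebra_simps)
    also have "K * d \<le> e" using e K by (simp add: d_def field_simps)
    finally show ?thesis by simp
  qed
  then show "(\<Sum>\<^sub>\<infinity>i\<in>?P. ?f i) powr (1 / t) \<le> K * 2 ^ m * form_norm m p T"
    unfolding R_def by (rule field_le_epsilon)
qed

definition finite_form :: "nat \<Rightarrow> nat \<Rightarrow> ((nat \<Rightarrow> nat) \<Rightarrow> complex) \<Rightarrow> (nat \<Rightarrow> nat \<Rightarrow> complex) \<Rightarrow> complex" where
  "finite_form m N a x = (\<Sum>i\<in>indices m N. a i * (\<Prod>j<m. x j (i j)))"

lemma multilinear_finite_form: "multilinear_form m p (finite_form m N a)"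
  unfolding multilinear_form_def
proof (intro ballI allI impI)
  fix x :: "nat \<Rightarrow> nat \<Rightarrow> complex" and k and u v :: "nat \<Rightarrow> complex" and c d :: complex
  assume k: "k < m"
  have *: "(\<Prod>j<m. (x(k := w)) j (i j)) = w (i k) * (\<Prod>j\<in>{..<m} - {k}. x j (i j))" for w i
    using k by (subst prod.remove[of _ k]) (auto intro!: prod.cong)
  show "finite_form m N a (x(k := (\<lambda>n. c * u n + d * v n)))
      = c * finite_form m N a (x(k := u)) + d * finite_form m N a (x(k := v))"
    unfolding finite_form_def * by (simp add: sum_distrib_left sum.distrib algebra_simps)
qed

lemma norm_coord_le_ell_norm:
  assumes p: "1 \<le> p" and x: "x \<in> ell p"
  shows "cmod (x n) \<le> ell_norm p x"
  using p
proof (cases rule: recip_exponent_cases)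
  case infinite
  have "bdd_above (range (\<lambda>n. cmod (x n)))"
    using x infinite by (auto simp: ell_def bounded_iff bdd_above_def)
  then show ?thesis
    using x infinite by (auto simp: ell_norm_def intro: cSUP_upper)
next
  case finite
  define r where "r = enn2real p"
  have r: "r \<ge> 1" using finite by (simp add: r_def)
  have "summable (\<lambda>n. cmod (x n) powr r)"
    using x finite by (simp add: ell_def r_def)
  then have "(\<Sum>k\<in>{n}. cmod (x k) powr r) \<le> (\<Sum>n. cmod (x n) powr r)"
    by (intro sum_le_suminf) auto
  then have "(cmod (x n) powr r) powr (1 / r) \<le> (\<Sum>n. cmod (x n) powr r) powr (1 / r)"
    using r by (intro powr_mono2) auto
  then show ?thesis
    using r x finite by (simp add: ell_norm_def r_def powr_powr)
qed

text \<open>The coordinates are contractions.\<close>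

lemma continuous_map_coord:
  assumes "1 \<le> p"
  shows "continuous_map (ell_topology p) euclidean (\<lambda>x. x n)"
proof -
  interpret Metric_space "ell p" "ell_dist p" by (rule Metric_space_ell[OF assms])
  have "continuous_map mtopology (Metric_space.mtopology UNIV dist) (\<lambda>x. x n)"
  proof (subst metric_continuous_map[OF Met_TC.Metric_space_axioms], intro conjI ballI allI impI)
    fix x and e :: real assume x: "x \<in> ell p" and e: "0 < e"
    have "dist (x n) (y n) < e" if "y \<in> ell p" "ell_dist p x y < e" for y
      using norm_coord_le_ell_norm[OF assms ell_diff[OF assms x that(1)], of n] that(2)
      by (simp add: dist_norm ell_dist_def)
    then show "\<exists>d>0. \<forall>y. y \<in> ell p \<and> ell_dist p x y < d \<longrightarrow> dist (x n) (y n) < e"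
      using e by blast
  qed auto
  then show ?thesis by (simp add: ell_topology_def)
qed

lemma continuous_map_cmult_prod:
  fixes f :: "'a \<Rightarrow> 'b \<Rightarrow> complex"
  assumes "finite I" "\<And>i. i \<in> I \<Longrightarrow> continuous_map X euclidean (\<lambda>x. f x i)"
  shows "continuous_map X euclidean (\<lambda>x. c * prod (f x) I)"
  using assms by (simp add: continuous_map_atin tendsto_mult_left tendsto_prod)

lemma cont_multilinear_finite_form:
  assumes p: "\<And>j. j < m \<Longrightarrow> 1 \<le> p j"
  shows "cont_multilinear_form m p (finite_form m N a)"
proof -
  have "continuous_map (product_topology (\<lambda>j. ell_topology (p j)) {..<m}) euclidean (\<lambda>x. x j n)"
    if "j < m" for j n
  proof -
    have "continuous_map (product_topology (\<lambda>j. ell_topology (p j)) {..<m}) (ell_topology (p j)) (\<lambda>x. x j)"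
      using that by (intro continuous_map_product_projection) auto
    from continuous_map_compose[OF this continuous_map_coord[OF p[OF that], of n]]
    show ?thesis by (simp add: o_def)
  qed
  then have "continuous_map (product_topology (\<lambda>j. ell_topology (p j)) {..<m}) euclidean (finite_form m N a)"
    unfolding finite_form_def by (intro continuous_map_sum continuous_map_cmult_prod) auto
  then show ?thesis
    by (simp add: cont_multilinear_form_def multilinear_finite_form)
qed

lemma form_coeff_finite_form:
  assumes i: "i \<in> (\<Pi>\<^sub>E j\<in>{..<m}. UNIV)"
  shows "form_coeff m (finite_form m N a) i = (if i \<in> indices m N then a i else 0)"
proof -
  have delta: "(\<Prod>j<m. unit_seq (i j) (k j)) = (if k = i then 1 else 0)"
    if "k \<in> indices m N" for k
  proof (cases "k = i")
    case False
    have "k \<in> extensional {..<m}" "i \<in> extensional {..<m}"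
      using i that by (auto simp: indices_def PiE_def)
    then obtain j where j: "j < m" "k j \<noteq> i j"
      using False extensionalityI[of k "{..<m}" i] by blast
    then have "unit_seq (i j) (k j) = 0"
      by (simp add: unit_seq_def)
    then show ?thesis using False j(1) by (auto intro!: prod_zero)
  qed (simp add: unit_seq_def)
  have "form_coeff m (finite_form m N a) i = (\<Sum>k\<in>indices m N. if k = i then a k else 0)"
    unfolding form_coeff_def finite_form_def
  proof (rule sum.cong[OF refl])
    fix k assume "k \<in> indices m N"
    then show "a k * (\<Prod>j<m. (\<lambda>j\<in>{..<m}. unit_seq (i j)) j (k j)) = (if k = i then a k else 0)"
      by (simp add: delta)
  qed
  also have "\<dots> = (if i \<in> indices m N then a i else 0)"
    by (rule sum.delta) (rule finite_indices)
  finally show ?thesis .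
qed

text \<open>The lower bounds for admissible exponents \<open>t\<close> come from forms of small norm with large coefficients.\<close>

lemma coeff_bound_finite_form:
  assumes p: "\<And>j. j < m \<Longrightarrow> 1 \<le> p j" and t: "0 < t" and C: "0 < C" and cb: "coeff_bound m p t C"
    and bd: "form_bound m N (\<lambda>j. enn2real (1 / p j)) a B"
  shows "(\<Sum>i\<in>indices m N. cmod (a i) powr t) powr (1 / t) \<le> C * B"
proof -
  let ?P = "\<Pi>\<^sub>E j\<in>{..<m}. (UNIV :: nat set)"
  let ?T = "finite_form m N a"
  have "form_norm m p ?T \<le> B"
    unfolding form_norm_def
  proof (intro cSUP_least)
    show "{x \<in> ell_prod m p. \<forall>j<m. ell_norm (p j) (x j) < 1} \<noteq> {}"
      unfolding ex_in_conv[symmetric] by (rule exI, rule zero_in_unit_balls[OF p])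
    fix x assume x: "x \<in> {x \<in> ell_prod m p. \<forall>j<m. ell_norm (p j) (x j) < 1}"
    have "\<exists>u. weights N u \<and> (\<forall>n<N. cmod (x j n) \<le> wpow (u n) (enn2real (1 / p j)))" if "j < m" for j
      using that x p by (intro weights_if_ell_norm_less_1) (auto simp: ell_prod_def)
    then obtain u where "\<And>j. j < m \<Longrightarrow> weights N (u j) \<and> (\<forall>n<N. cmod (x j n) \<le> wpow (u j n) (enn2real (1 / p j)))"
      by metis
    then show "cmod (?T x) \<le> B"
      unfolding finite_form_def by (intro form_boundD[OF bd]) auto
  qed
  then have "C * form_norm m p ?T \<le> C * B"
    using C by (intro mult_left_mono) auto
  have "(\<Sum>\<^sub>\<infinity>i\<in>?P. cmod (form_coeff m ?T i) powr t) = (\<Sum>\<^sub>\<infinity>i\<in>indices m N. cmod (a i) powr t)"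
    using indices_subset_PiE by (intro infsum_cong_neutral) (auto simp: form_coeff_finite_form)
  then have "(\<Sum>i\<in>indices m N. cmod (a i) powr t) powr (1 / t)
      = (\<Sum>\<^sub>\<infinity>i\<in>?P. cmod (form_coeff m ?T i) powr t) powr (1 / t)"
    by simp
  also have "\<dots> \<le> C * form_norm m p ?T"
  proof -
    have "cont_multilinear_form m p ?T"
      by (rule cont_multilinear_finite_form) (rule p)
    then show ?thesis using cb unfolding coeff_bound_def by blast
  qed
  also note \<open>C * form_norm m p ?T \<le> C * B\<close>
  finally show ?thesis .
qed

section \<open>Diagonal forms\<close>

lemma wpow_mult_left:
  assumes "0 \<le> c" "0 \<le> u"
  shows "wpow (c * u) a = wpow c a * wpow u a"
  using assms by (simp add: wpow_def powr_mult)

lemma wpow_pos: "0 < c \<Longrightarrow> wpow c a = c powr a"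
  by (simp add: wpow_def)

lemma wpow_le_exp:
  assumes "0 \<le> y" "0 \<le> a"
  shows "wpow y a \<le> exp (a * (y - 1))"
proof (cases "a = 0")
  case False
  have "y powr a \<le> exp (y - 1) powr a"
    using exp_ge_add_one_self[of "y - 1"] assms by (intro powr_mono2) auto
  then show ?thesis using False by (simp add: wpow_def powr_def mult.commute)
qed (simp add: wpow_def)

text \<open>
  The weighted inequality of arithmetic and geometric means, where the number \<open>1\<close> carries the
  remaining weight \<open>1 - (\<Sum>j<m. \<alpha> j)\<close>. Dividing by the mean \<open>A\<close>, this is \<open>y \<le> exp (y - 1)\<close>.
\<close>

lemma prod_wpow_le_mean:
  fixes m :: nat
  assumes y: "\<And>j. j < m \<Longrightarrow> 0 \<le> y j" and al: "\<And>j. j < m \<Longrightarrow> 0 \<le> \<alpha> j" and s: "(\<Sum>j<m. \<alpha> j) < 1"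
  shows "(\<Prod>j<m. wpow (y j) (\<alpha> j)) \<le> (\<Sum>j<m. \<alpha> j * y j) + (1 - (\<Sum>j<m. \<alpha> j))"
proof -
  define S where "S = (\<Sum>j<m. \<alpha> j)"
  define A where "A = (\<Sum>j<m. \<alpha> j * y j) + (1 - S)"
  have "(\<Sum>j<m. \<alpha> j * y j) \<ge> 0" using y al by (intro sum_nonneg) auto
  then have A: "A > 0" using s by (simp add: A_def S_def)
  have "wpow (y j) (\<alpha> j) \<le> A powr \<alpha> j * exp (\<alpha> j * (y j / A - 1))" if "j < m" for j
  proof -
    have "wpow (y j) (\<alpha> j) = wpow (A * (y j / A)) (\<alpha> j)" using A by simp
    also have "\<dots> = A powr \<alpha> j * wpow (y j / A) (\<alpha> j)"
      using A y[OF that] by (subst wpow_mult_left) (auto simp: wpow_pos)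
    also have "\<dots> \<le> A powr \<alpha> j * exp (\<alpha> j * (y j / A - 1))"
      using A y[OF that] al[OF that] by (intro mult_left_mono wpow_le_exp) auto
    finally show ?thesis .
  qed
  then have "(\<Prod>j<m. wpow (y j) (\<alpha> j)) \<le> (\<Prod>j<m. A powr \<alpha> j * exp (\<alpha> j * (y j / A - 1)))"
    by (intro prod_mono) auto
  also have "\<dots> = A powr S * exp (\<Sum>j<m. \<alpha> j * (y j / A - 1))"
    using A by (simp only: exp_sum[OF finite_lessThan] prod.distrib S_def powr_sum[OF less_imp_neq[OF A, symmetric]])
  also have "(\<Sum>j<m. \<alpha> j * (y j / A - 1)) = (1 - S) * (1 - 1 / A)"
  proof -
    have "(\<Sum>j<m. \<alpha> j * (y j / A - 1)) = (\<Sum>j<m. \<alpha> j * y j) / A - S"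
      by (simp add: algebra_simps sum_subtractf S_def sum_divide_distrib)
    also have "(\<Sum>j<m. \<alpha> j * y j) = A - (1 - S)" by (simp add: A_def)
    finally show ?thesis using A by (simp add: field_simps)
  qed
  also have "A powr S * exp ((1 - S) * (1 - 1 / A)) \<le> A powr S * A powr (1 - S)"
  proof (rule mult_left_mono)
    have "1 - 1 / A \<le> ln A"
      using ln_add_one_self_le_self2[of "1 / A - 1"] A by (simp add: ln_div)
    then have "(1 - S) * (1 - 1 / A) \<le> (1 - S) * ln A"
      using s by (intro mult_left_mono) (auto simp: S_def)
    then show "exp ((1 - S) * (1 - 1 / A)) \<le> A powr (1 - S)"
      using A by (simp add: powr_def)
  qed simp
  also have "\<dots> = A" using A by (simp flip: powr_add)
  finally show ?thesis by (simp add: A_def S_def)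
qed

definition diagonal_index :: "nat \<Rightarrow> nat \<Rightarrow> nat \<Rightarrow> nat" where
  "diagonal_index m n = (\<lambda>j\<in>{..<m}. n)"

definition diagonal_coeff :: "nat \<Rightarrow> nat \<Rightarrow> (nat \<Rightarrow> nat) \<Rightarrow> complex" where
  "diagonal_coeff m N i = (if i \<in> diagonal_index m ` {..<N} then 1 else 0)"

lemma sum_diagonal:
  fixes f :: "(nat \<Rightarrow> nat) \<Rightarrow> 'a :: comm_monoid_add"
  assumes "1 \<le> m"
  shows "(\<Sum>i\<in>indices m N. if i \<in> diagonal_index m ` {..<N} then f i else 0) = (\<Sum>n<N. f (diagonal_index m n))"
proof -
  have "diagonal_index m ` {..<N} \<subseteq> indices m N"
    by (auto simp: diagonal_index_def indices_def split: if_splits)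
  then have "(\<Sum>i\<in>indices m N. if i \<in> diagonal_index m ` {..<N} then f i else 0) = sum f (diagonal_index m ` {..<N})"
    by (subst sum.inter_restrict[symmetric]) (auto simp: Int_absorb1)
  also have "inj_on (diagonal_index m) {..<N}"
    using assms by (intro inj_onI) (auto simp: diagonal_index_def fun_eq_iff restrict_def dest!: spec[of _ 0])
  then have "sum f (diagonal_index m ` {..<N}) = (\<Sum>n<N. f (diagonal_index m n))"
    by (rule sum.reindex_cong) auto
  finally show ?thesis .
qed

text \<open>
  Hoelder's inequality for \<open>m\<close> functions. The inequality of means is applied to the numbers \<open>N * u j n\<close>, whose
  average over \<open>n < N\<close> is at most \<open>1\<close>.
\<close>

lemma form_bound_diagonal:
  assumes m: "1 \<le> m" and N: "1 \<le> N" and al: "\<And>j. j < m \<Longrightarrow> 0 \<le> \<alpha> j" and s: "(\<Sum>j<m. \<alpha> j) < 1"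
  shows "form_bound m N \<alpha> (diagonal_coeff m N) (real N powr (1 - (\<Sum>j<m. \<alpha> j)))"
  unfolding form_bound_def
proof (intro allI impI)
  fix u and x :: "nat \<Rightarrow> nat \<Rightarrow> complex"
  assume u: "\<forall>j<m. weights N (u j)" and x: "\<forall>j<m. \<forall>n<N. cmod (x j n) \<le> wpow (u j n) (\<alpha> j)"
  define S where "S = (\<Sum>j<m. \<alpha> j)"
  have "(\<Sum>i\<in>indices m N. diagonal_coeff m N i * (\<Prod>j<m. x j (i j)))
      = (\<Sum>n<N. \<Prod>j<m. x j (diagonal_index m n j))"
  proof -
    have "(\<Sum>i\<in>indices m N. diagonal_coeff m N i * (\<Prod>j<m. x j (i j)))
        = (\<Sum>i\<in>indices m N. if i \<in> diagonal_index m ` {..<N} then \<Prod>j<m. x j (i j) else 0)"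
      by (intro sum.cong) (auto simp: diagonal_coeff_def)
    then show ?thesis by (simp only: sum_diagonal[OF m])
  qed
  then have "cmod (\<Sum>i\<in>indices m N. diagonal_coeff m N i * (\<Prod>j<m. x j (i j))) = cmod (\<Sum>n<N. \<Prod>j<m. x j n)"
    by (simp add: diagonal_index_def)
  also have "\<dots> \<le> (\<Sum>n<N. \<Prod>j<m. wpow (u j n) (\<alpha> j))"
    using x by (intro sum_norm_le) (auto simp: prod_norm[symmetric] intro!: prod_mono)
  also have "\<dots> \<le> (\<Sum>n<N. real N powr (- S) * ((\<Sum>j<m. \<alpha> j * (real N * u j n)) + (1 - S)))"
  proof (intro sum_mono)
    fix n assume n: "n \<in> {..<N}"
    have u0: "0 \<le> u j n" if "j < m" for j
      using u n that by (auto intro: weights_nonneg)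
    have "(\<Prod>j<m. wpow (real N * u j n) (\<alpha> j)) = real N powr S * (\<Prod>j<m. wpow (u j n) (\<alpha> j))"
    proof -
      have "(\<Prod>j<m. wpow (real N * u j n) (\<alpha> j)) = (\<Prod>j<m. real N powr \<alpha> j * wpow (u j n) (\<alpha> j))"
        using N u0 by (intro prod.cong) (auto simp: wpow_mult_left wpow_pos)
      then show ?thesis using N by (simp add: prod.distrib S_def powr_sum)
    qed
    moreover have "(\<Prod>j<m. wpow (real N * u j n) (\<alpha> j)) \<le> (\<Sum>j<m. \<alpha> j * (real N * u j n)) + (1 - S)"
      unfolding S_def using u0 al s by (intro prod_wpow_le_mean) auto
    ultimately show "(\<Prod>j<m. wpow (u j n) (\<alpha> j)) \<le> real N powr (- S) * ((\<Sum>j<m. \<alpha> j * (real N * u j n)) + (1 - S))"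
      using N by (simp add: powr_minus field_simps)
  qed
  also have "\<dots> = real N powr (- S) * (real N * (\<Sum>j<m. \<alpha> j * (\<Sum>n<N. u j n)) + real N * (1 - S))"
  proof -
    have "(\<Sum>n<N. \<Sum>j<m. \<alpha> j * (real N * u j n)) = real N * (\<Sum>j<m. \<alpha> j * (\<Sum>n<N. u j n))"
      by (subst sum.swap) (simp add: sum_distrib_left mult_ac)
    then show ?thesis by (simp add: sum.distrib flip: sum_distrib_left)
  qed
  also have "\<dots> \<le> real N powr (- S) * (real N * (\<Sum>j<m. \<alpha> j * 1) + real N * (1 - S))"
    using u al by (intro mult_left_mono add_right_mono sum_mono) (auto simp: weights_def)
  also have "\<dots> = real N powr (- S) * real N powr 1"
    using N by (simp add: S_def algebra_simps)
  also have "\<dots> = real N powr (1 - S)"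
    unfolding powr_add[symmetric] by simp
  finally show "cmod (\<Sum>i\<in>indices m N. diagonal_coeff m N i * (\<Prod>j<m. x j (i j))) \<le> real N powr (1 - (\<Sum>j<m. \<alpha> j))"
    by (simp add: S_def)
qed

lemma sum_diagonal_coeff:
  assumes "1 \<le> m" "0 < t"
  shows "(\<Sum>i\<in>indices m N. cmod (diagonal_coeff m N i) powr t) = real N"
proof -
  have "(\<Sum>i\<in>indices m N. cmod (diagonal_coeff m N i) powr t)
      = (\<Sum>i\<in>indices m N. if i \<in> diagonal_index m ` {..<N} then 1 else 0)"
    by (intro sum.cong) (auto simp: diagonal_coeff_def)
  then show ?thesis using sum_diagonal[OF assms(1), of N "\<lambda>_. 1 :: real"] by simp
qed


section \<open>Random signs\<close>

text \<open>Compare the power series, using \<open>2 ^ n * fact n \<le> fact (2 * n)\<close>.\<close>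

lemma cosh_le_exp_half_square: "cosh x \<le> exp (x\<^sup>2 / 2)" for x :: real
proof -
  have 1: "(\<lambda>n. if even n then x ^ n /\<^sub>R fact n else 0) sums cosh x"
    by (rule cosh_converges)
  have 2: "(\<lambda>n. (x\<^sup>2 / 2) ^ n /\<^sub>R fact n) sums exp (x\<^sup>2 / 2)"
    by (rule exp_converges)
  have "(\<lambda>n. (if even (2 * n) then x ^ (2 * n) /\<^sub>R fact (2 * n) else 0)) sums cosh x"
    using 1 by (subst sums_mono_reindex[of "\<lambda>n. 2 * n"]) (auto simp: strict_mono_def elim!: oddE)
  then have 3: "(\<lambda>n. x ^ (2 * n) /\<^sub>R fact (2 * n)) sums cosh x"
    by simp
  have fact: "2 ^ n * fact n \<le> (fact (2 * n) :: real)" for n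
  proof (induction n)
    case (Suc n)
    have "2 ^ Suc n * fact (Suc n) = 2 * real (Suc n) * (2 ^ n * fact n)" by simp
    also have "\<dots> \<le> 2 * real (Suc n) * ((2 * n + 1) * fact (2 * n))"
      using Suc by (intro mult_left_mono order_trans[OF Suc]) (auto simp: mult_le_cancel_right1)
    also have "\<dots> = fact (2 * Suc n)" by (simp add: algebra_simps)
    finally show ?case .
  qed simp
  have "x ^ (2 * n) /\<^sub>R fact (2 * n) \<le> (x\<^sup>2 / 2) ^ n /\<^sub>R fact n" for n
  proof -
    have "x ^ (2 * n) / fact (2 * n) \<le> x ^ (2 * n) / (2 ^ n * fact n)"
      using fact[of n] by (intro divide_left_mono) (auto simp: power_mult)
    moreover have "x ^ (2 * n) / (2 ^ n * fact n) = (x\<^sup>2 / 2) ^ n /\<^sub>R fact n"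
      unfolding power_mult power_divide by (simp add: field_simps)
    ultimately show ?thesis by (simp only: real_scaleR_def divide_inverse mult.commute)
  qed
  then show ?thesis by (rule sums_le[OF _ 3 2])
qed

text \<open>
  The average of \<open>exp (\<theta> * (\<Sum>i\<in>I. e i * b i))\<close> over all signs is at most \<open>exp (\<theta>\<^sup>2 / 2)\<close>, so for
  some choice of signs the sum over all \<open>b \<in> Y\<close> is at most \<open>card Y * exp (\<theta>\<^sup>2 / 2)\<close>.
\<close>

lemma exists_signs:
  fixes Y :: "('a \<Rightarrow> real) set"
  assumes I: "finite I" and Y: "finite Y" "Y \<noteq> {}" and th: "0 < \<theta>"
    and b: "\<And>b. b \<in> Y \<Longrightarrow> (\<Sum>i\<in>I. (b i)\<^sup>2) \<le> 1"
  shows "\<exists>e\<in>PiE I (\<lambda>_. {-1, 1}). \<forall>b\<in>Y. (\<Sum>i\<in>I. e i * b i) \<le> ln (card Y) / \<theta> + \<theta> / 2"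
proof -
  define \<Omega> where "\<Omega> = PiE I (\<lambda>_. {-1, 1 :: real})"
  have fin: "finite \<Omega>" and card: "real (card \<Omega>) = 2 ^ card I"
    using I by (auto simp: \<Omega>_def card_PiE numeral_2_eq_2 intro!: finite_PiE)
  have moment: "(\<Sum>e\<in>\<Omega>. exp (\<theta> * (\<Sum>i\<in>I. e i * b i))) \<le> 2 ^ card I * exp (\<theta>\<^sup>2 / 2)" if "b \<in> Y" for b
  proof -
    have "(\<Sum>e\<in>\<Omega>. exp (\<theta> * (\<Sum>i\<in>I. e i * b i))) = (\<Sum>e\<in>\<Omega>. \<Prod>i\<in>I. exp (\<theta> * (e i * b i)))"
      using I by (simp add: exp_sum sum_distrib_left)
    also have "\<dots> = (\<Prod>i\<in>I. \<Sum>y\<in>{-1, 1}. exp (\<theta> * (y * b i)))"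
      unfolding \<Omega>_def using I by (intro prod_sum_PiE[symmetric]) auto
    also have "\<dots> = (\<Prod>i\<in>I. 2 * cosh (\<theta> * b i))"
      by (intro prod.cong) (auto simp: cosh_def)
    also have "\<dots> \<le> (\<Prod>i\<in>I. 2 * exp ((\<theta> * b i)\<^sup>2 / 2))"
      using cosh_le_exp_half_square by (intro prod_mono) (auto simp: cosh_real_nonneg)
    also have "\<dots> = 2 ^ card I * exp (\<theta>\<^sup>2 / 2 * (\<Sum>i\<in>I. (b i)\<^sup>2))"
    proof -
      have "(\<Prod>i\<in>I. exp ((\<theta> * b i)\<^sup>2 / 2)) = exp (\<Sum>i\<in>I. (\<theta> * b i)\<^sup>2 / 2)"
        by (rule exp_sum[OF I, symmetric])
      also have "(\<Sum>i\<in>I. (\<theta> * b i)\<^sup>2 / 2) = \<theta>\<^sup>2 / 2 * (\<Sum>i\<in>I. (b i)\<^sup>2)"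
        by (simp add: sum_distrib_left power_mult_distrib)
      finally show ?thesis by (simp only: prod.distrib prod_constant)
    qed
    also have "\<dots> \<le> 2 ^ card I * exp (\<theta>\<^sup>2 / 2 * 1)"
    proof -
      have "\<theta>\<^sup>2 / 2 * (\<Sum>i\<in>I. (b i)\<^sup>2) \<le> \<theta>\<^sup>2 / 2 * 1"
        by (intro mult_left_mono b[OF that]) auto
      then show ?thesis by simp
    qed
    finally show ?thesis by simp
  qed
  define F where "F e = (\<Sum>b\<in>Y. exp (\<theta> * (\<Sum>i\<in>I. e i * b i)))" for e
  have "(\<Sum>e\<in>\<Omega>. F e) = (\<Sum>b\<in>Y. \<Sum>e\<in>\<Omega>. exp (\<theta> * (\<Sum>i\<in>I. e i * b i)))"
    unfolding F_def by (rule sum.swap)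
  also have "\<dots> \<le> (\<Sum>b\<in>Y. 2 ^ card I * exp (\<theta>\<^sup>2 / 2))"
    by (intro sum_mono moment)
  also have "\<dots> = (\<Sum>e\<in>\<Omega>. card Y * exp (\<theta>\<^sup>2 / 2))"
    by (simp add: card)
  finally have avg: "(\<Sum>e\<in>\<Omega>. F e) \<le> (\<Sum>e\<in>\<Omega>. card Y * exp (\<theta>\<^sup>2 / 2))" .
  have "\<Omega> \<noteq> {}" by (auto simp: \<Omega>_def PiE_eq_empty_iff)
  have "\<exists>e\<in>\<Omega>. F e \<le> card Y * exp (\<theta>\<^sup>2 / 2)"
  proof (rule ccontr)
    assume "\<not> ?thesis"
    then have "(\<Sum>e\<in>\<Omega>. card Y * exp (\<theta>\<^sup>2 / 2)) < (\<Sum>e\<in>\<Omega>. F e)"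
      using fin \<open>\<Omega> \<noteq> {}\<close> by (intro sum_strict_mono) auto
    then show False using avg by simp
  qed
  then obtain e where e: "e \<in> \<Omega>" "F e \<le> card Y * exp (\<theta>\<^sup>2 / 2)" by blast
  have "(\<Sum>i\<in>I. e i * b i) \<le> ln (card Y) / \<theta> + \<theta> / 2" if "b \<in> Y" for b
  proof -
    have cY: "real (card Y) > 0" using Y by (simp add: card_gt_0_iff)
    have "exp (\<theta> * (\<Sum>i\<in>I. e i * b i)) \<le> F e"
      unfolding F_def using Y that by (intro member_le_sum) auto
    also note e(2)
    also have "card Y * exp (\<theta>\<^sup>2 / 2) = exp (ln (card Y) + \<theta>\<^sup>2 / 2)"
      using cY by (simp add: exp_add)
    finally have "\<theta> * (\<Sum>i\<in>I. e i * b i) \<le> ln (card Y) + \<theta>\<^sup>2 / 2" by simp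
    then show ?thesis using th by (simp add: field_simps power2_eq_square)
  qed
  then show ?thesis using e(1) by (auto simp: \<Omega>_def)
qed

text \<open>
  Rounding to multiples of \<open>1 / L\<close>. The direction towards \<open>0\<close> ensures that rounded vectors do not
  leave the unit balls.
\<close>

definition round_to_0 :: "nat \<Rightarrow> real \<Rightarrow> int" where
  "round_to_0 L x = (if 0 \<le> x then \<lfloor>x * L\<rfloor> else - \<lfloor>- x * L\<rfloor>)"

definition grid_point :: "nat \<Rightarrow> int \<times> int \<Rightarrow> complex" where
  "grid_point L z = Complex (of_int (fst z) / L) (of_int (snd z) / L)"

definition round_complex :: "nat \<Rightarrow> complex \<Rightarrow> complex" where
  "round_complex L z = grid_point L (round_to_0 L (Re z), round_to_0 L (Im z))"

lemma round_to_0: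
  assumes L: "1 \<le> L"
  shows "\<bar>of_int (round_to_0 L x) / real L\<bar> \<le> \<bar>x\<bar>" "\<bar>x - of_int (round_to_0 L x) / real L\<bar> \<le> 1 / L"
proof -
  have *: "0 \<le> of_int \<lfloor>y * L\<rfloor> / real L" "of_int \<lfloor>y * L\<rfloor> / real L \<le> y" "y - of_int \<lfloor>y * L\<rfloor> / real L \<le> 1 / L"
    if "0 \<le> y" for y :: real
  proof -
    have L0: "real L > 0" using L by simp
    show "0 \<le> of_int \<lfloor>y * L\<rfloor> / real L" using that by simp
    show "of_int \<lfloor>y * L\<rfloor> / real L \<le> y" using L0 by (simp add: pos_divide_le_eq)
    have "y * L \<le> of_int \<lfloor>y * L\<rfloor> + 1" by linarith
    then have "y \<le> (of_int \<lfloor>y * L\<rfloor> + 1) / L" using L0 by (simp add: pos_le_divide_eq)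
    then show "y - of_int \<lfloor>y * L\<rfloor> / real L \<le> 1 / L" by (simp add: add_divide_distrib)
  qed
  show "\<bar>of_int (round_to_0 L x) / real L\<bar> \<le> \<bar>x\<bar>" "\<bar>x - of_int (round_to_0 L x) / real L\<bar> \<le> 1 / L"
    using *[of x] *[of "- x"] unfolding round_to_0_def by (cases "0 \<le> x"; simp)+
qed

lemma round_complex:
  assumes L: "1 \<le> L"
  shows "cmod (round_complex L z) \<le> cmod z" "cmod (z - round_complex L z) \<le> 2 / L"
proof -
  show "cmod (round_complex L z) \<le> cmod z"
    unfolding cmod_def round_complex_def grid_point_def using round_to_0(1)[OF L]
    by (intro real_sqrt_le_mono add_mono) (auto simp: abs_le_square_iff[symmetric])
  have "cmod (z - round_complex L z) \<le> \<bar>Re (z - round_complex L z)\<bar> + \<bar>Im (z - round_complex L z)\<bar>"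
    by (rule cmod_le)
  also have "\<dots> \<le> 1 / L + 1 / L"
    using round_to_0(2)[OF L] by (intro add_mono) (simp_all add: round_complex_def grid_point_def)
  finally show "cmod (z - round_complex L z) \<le> 2 / L" by simp
qed

lemma round_complex_in_grid:
  assumes L: "1 \<le> L" and z: "cmod z \<le> 1"
  shows "round_complex L z \<in> grid_point L ` ({- int L..int L} \<times> {- int L..int L})"
proof -
  have "round_to_0 L x \<in> {- int L..int L}" if "\<bar>x\<bar> \<le> 1" for x
  proof -
    have "\<bar>of_int (round_to_0 L x) / real L\<bar> \<le> 1"
      using round_to_0(1)[OF L, of x] that by simp
    then have "\<bar>real_of_int (round_to_0 L x)\<bar> \<le> real L"
      using L by (simp add: abs_divide divide_le_eq_1)
    then show ?thesis by (simp add: abs_le_iff)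
  qed
  then show ?thesis
    using z abs_Re_le_cmod[of z] abs_Im_le_cmod[of z] by (auto simp: round_complex_def)
qed

definition unit_grid :: "nat \<Rightarrow> nat \<Rightarrow> (nat \<Rightarrow> complex) set" where
  "unit_grid L N = {y \<in> PiE {..<N} (\<lambda>_. grid_point L ` ({- int L..int L} \<times> {- int L..int L})).
     (\<Sum>n<N. (cmod (y n))\<^sup>2) \<le> 1}"

lemma unit_grid_card:
  "finite (unit_grid L N)" "card (unit_grid L N) \<le> ((2 * L + 1)\<^sup>2) ^ N"
proof -
  let ?G = "grid_point L ` ({- int L..int L} \<times> {- int L..int L})"
  have fin: "finite (PiE {..<N} (\<lambda>_. ?G))" by (intro finite_PiE) auto
  then show "finite (unit_grid L N)" by (simp add: unit_grid_def)
  have "card (unit_grid L N) \<le> card (PiE {..<N} (\<lambda>_. ?G))"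
    using fin by (intro card_mono) (auto simp: unit_grid_def)
  also have "\<dots> = card ?G ^ N" by (simp add: card_PiE)
  also have "card ?G \<le> card ({- int L..int L} \<times> {- int L..int L})"
    by (intro card_image_le) auto
  then have "card ?G ^ N \<le> ((2 * L + 1)\<^sup>2) ^ N"
    by (intro power_mono) (simp_all add: card_cartesian_product power2_eq_square nat_add_distrib nat_mult_distrib)
  finally show "card (unit_grid L N) \<le> ((2 * L + 1)\<^sup>2) ^ N" .
qed

lemma unit_grid_nonempty: "unit_grid L N \<noteq> {}"
proof -
  have "grid_point L (0, 0) \<in> grid_point L ` ({- int L..int L} \<times> {- int L..int L})"
    by (rule imageI) auto
  moreover have "grid_point L (0, 0) = 0"
    by (simp add: grid_point_def complex_eq_iff)
  ultimately have "(\<lambda>n\<in>{..<N}. 0) \<in> unit_grid L N"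
    unfolding unit_grid_def by simp
  then show ?thesis by blast
qed

lemma norm_le_of_four_phases:
  assumes "\<And>c. c \<in> {1, -1, \<i>, -\<i>} \<Longrightarrow> Re (c * z) \<le> R"
  shows "cmod z \<le> 2 * R"
proof -
  have "\<bar>Re z\<bar> \<le> R" "\<bar>Im z\<bar> \<le> R"
    using assms[of 1] assms[of "-1"] assms[of \<i>] assms[of "-\<i>"] by auto
  then show ?thesis using cmod_le[of z] by simp
qed

text \<open>
  The signs are good for all points of a grid in the Euclidean unit balls simultaneously. The mesh
  \<open>1 / N ^ m\<close> is so fine that passing from a point to the grid changes the value of any form
  with unimodular coefficients by at most \<open>2 * m\<close>, and still the grid has only about
  \<open>N powr (2 * m\<^sup>2 * N)\<close> points, which costs a logarithmic factor.
\<close>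

lemma random_form:
  assumes m: "1 \<le> m" and N: "1 \<le> N"
  defines "R \<equiv> ln (4 * real (2 * N ^ m + 1) ^ (2 * N * m)) / sqrt N + sqrt N / 2"
  shows "\<exists>e\<in>PiE (indices m N) (\<lambda>_. {-1, 1 :: real}). \<forall>y. (\<forall>j<m. (\<Sum>n<N. (cmod (y j n))\<^sup>2) \<le> 1) \<longrightarrow>
    cmod (\<Sum>i\<in>indices m N. complex_of_real (e i) * (\<Prod>j<m. y j (i j))) \<le> 2 * R + 2 * m"
proof -
  define L where "L = N ^ m"
  have L: "1 \<le> L" using N by (simp add: L_def)
  define Net where "Net = PiE {..<m} (\<lambda>_. unit_grid L N)"
  \<comment> \<open>The real parts for the four phases \<open>c\<close> control the modulus.\<close>
  define f where "f = (\<lambda>(c, y :: nat \<Rightarrow> nat \<Rightarrow> complex) (i :: nat \<Rightarrow> nat). Re (c * (\<Prod>j<m. y j (i j))))"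
  define Y where "Y = f ` ({1, -1, \<i>, -\<i>} \<times> Net)"
  have finNet: "finite Net"
    unfolding Net_def by (intro finite_PiE unit_grid_card) auto
  then have finY: "finite Y" by (simp add: Y_def)
  have neY: "Y \<noteq> {}"
    using unit_grid_nonempty by (auto simp: Y_def Net_def PiE_eq_empty_iff)
  have cardY: "real (card Y) \<le> 4 * real (2 * N ^ m + 1) ^ (2 * N * m)"
  proof -
    have "card Y \<le> card ({1, -1, \<i>, -\<i>} \<times> Net)"
      unfolding Y_def using finNet by (intro card_image_le) auto
    also have "\<dots> \<le> 4 * card Net"
      by (simp add: card_cartesian_product card_insert_if)
    also have "card Net = card (unit_grid L N) ^ m" by (simp add: Net_def card_PiE)
    also have "4 * card (unit_grid L N) ^ m \<le> 4 * (((2 * L + 1)\<^sup>2) ^ N) ^ m"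
      by (intro mult_left_mono power_mono unit_grid_card) auto
    also have "\<dots> = 4 * (2 * L + 1) ^ (2 * N * m)"
      by (simp add: power_mult)
    finally have "real (card Y) \<le> real (4 * (2 * L + 1) ^ (2 * N * m))"
      by (simp only: of_nat_le_iff)
    then show ?thesis by (simp add: L_def)
  qed
  have norm_b: "(\<Sum>i\<in>indices m N. (b i)\<^sup>2) \<le> 1" if bY: "b \<in> Y" for b
  proof -
    obtain z where z: "b = f z" "z \<in> {1, -1, \<i>, -\<i>} \<times> Net"
      using bY unfolding Y_def by blast
    define c y where "c = fst z" and "y = snd z"
    have c: "c \<in> {1, -1, \<i>, -\<i>}" and y: "y \<in> Net" and b: "b = f (c, y)"
      using z by (auto simp: c_def y_def)
    have "(\<Sum>i\<in>indices m N. (b i)\<^sup>2) \<le> (\<Sum>i\<in>indices m N. \<Prod>j<m. (cmod (y j (i j)))\<^sup>2)"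
    proof (intro sum_mono)
      fix i
      have "\<bar>b i\<bar> \<le> cmod (c * (\<Prod>j<m. y j (i j)))"
        unfolding b f_def by (simp add: abs_Re_le_cmod del: times_complex.sel)
      also have "\<dots> = (\<Prod>j<m. cmod (y j (i j)))"
        using c by (auto simp: norm_mult prod_norm)
      finally have "\<bar>b i\<bar>\<^sup>2 \<le> (\<Prod>j<m. cmod (y j (i j)))\<^sup>2" by (intro power_mono) auto
      then show "(b i)\<^sup>2 \<le> (\<Prod>j<m. (cmod (y j (i j)))\<^sup>2)" by (simp add: prod_power_distrib)
    qed
    also have "\<dots> = (\<Prod>j<m. \<Sum>n<N. (cmod (y j n))\<^sup>2)"
      by (rule sum_indices_prod)
    also have "\<dots> \<le> 1"
      using y by (intro prod_le_1) (auto simp: Net_def unit_grid_def sum_nonneg dest!: PiE_mem)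
    finally show ?thesis .
  qed
  \<comment> \<open>As \<open>ln (card Y)\<close> is about \<open>N * ln N\<close>, the choice \<open>\<theta> = \<surd>N\<close> costs only a factor \<open>ln N\<close>.\<close>
  obtain e where e: "e \<in> PiE (indices m N) (\<lambda>_. {-1, 1 :: real})"
    and eb: "\<And>b. b \<in> Y \<Longrightarrow> (\<Sum>i\<in>indices m N. e i * b i) \<le> ln (card Y) / sqrt N + sqrt N / 2"
    using exists_signs[OF finite_indices finY neY _ norm_b, of "sqrt N"] N by auto
  have e1: "\<bar>e i\<bar> = 1" if "i \<in> indices m N" for i
    using e that by (auto dest!: PiE_mem)
  define T where "T y = (\<Sum>i\<in>indices m N. complex_of_real (e i) * (\<Prod>j<m. y j (i j)))" for y
  have "cmod (T y) \<le> 2 * R + 2 * m" if y: "\<forall>j<m. (\<Sum>n<N. (cmod (y j n))\<^sup>2) \<le> 1" for y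
  proof -
    define y' where "y' = (\<lambda>j\<in>{..<m}. \<lambda>n\<in>{..<N}. round_complex L (y j n))"
    have y1: "cmod (y j n) \<le> 1" if "j < m" "n < N" for j n
    proof -
      have "(cmod (y j n))\<^sup>2 \<le> (\<Sum>n<N. (cmod (y j n))\<^sup>2)"
        using that by (intro member_le_sum) auto
      then have "(cmod (y j n))\<^sup>2 \<le> 1\<^sup>2" using y that by fastforce
      then show ?thesis by (rule power2_le_imp_le) simp
    qed
    have y': "cmod (y' j n) \<le> cmod (y j n)" "cmod (y j n - y' j n) \<le> 2 / L" if "j < m" "n < N" for j n
      using that round_complex[OF L] by (auto simp: y'_def)
    have "y' \<in> Net"
      unfolding Net_def y'_def
    proof (intro restrict_PiE_iff[THEN iffD2] ballI)
      fix j assume j: "j \<in> {..<m}"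
      have "(\<Sum>n<N. (cmod (round_complex L (y j n)))\<^sup>2) \<le> (\<Sum>n<N. (cmod (y j n))\<^sup>2)"
        using round_complex[OF L] by (intro sum_mono power_mono) auto
      also have "\<dots> \<le> 1" using y j by simp
      finally show "(\<lambda>n\<in>{..<N}. round_complex L (y j n)) \<in> unit_grid L N"
        unfolding unit_grid_def using round_complex_in_grid[OF L y1] j by auto
    qed
    have "cmod (T y') \<le> 2 * R"
    proof (rule norm_le_of_four_phases)
      fix c :: complex assume c: "c \<in> {1, -1, \<i>, -\<i>}"
      have "Re (c * T y') = (\<Sum>i\<in>indices m N. e i * f (c, y') i)"
      proof -
        have "c * T y' = (\<Sum>i\<in>indices m N. complex_of_real (e i) * (c * (\<Prod>j<m. y' j (i j))))"
          unfolding T_def sum_distrib_left by (intro sum.cong refl) (rule mult.left_commute)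
        moreover have "Re (complex_of_real r * w) = r * Re w" for r w
          by simp
        ultimately show ?thesis by (simp only: f_def Re_sum split)
      qed
      also have "\<dots> \<le> ln (card Y) / sqrt N + sqrt N / 2"
        using c \<open>y' \<in> Net\<close> by (intro eb) (auto simp: Y_def)
      also have "\<dots> \<le> R"
        unfolding R_def using cardY finY neY N
        by (intro add_right_mono divide_right_mono ln_mono) (auto simp: card_gt_0_iff)
      finally show "Re (c * T y') \<le> R" .
    qed
    moreover have "cmod (T y - T y') \<le> 2 * m"
    proof -
      have "T y - T y' = (\<Sum>i\<in>indices m N. complex_of_real (e i) * ((\<Prod>j<m. y j (i j)) - (\<Prod>j<m. y' j (i j))))"
        by (simp add: T_def sum_subtractf right_diff_distrib)
      also have "cmod \<dots> \<le> (\<Sum>i\<in>indices m N. m * (2 / L))"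
      proof (intro sum_norm_le)
        fix i assume i: "i \<in> indices m N"
        have "cmod ((\<Prod>j<m. y j (i j)) - (\<Prod>j<m. y' j (i j))) \<le> (\<Sum>j<m. cmod (y j (i j) - y' j (i j)))"
        proof (rule norm_prod_diff)
          fix j assume "j \<in> {..<m}"
          then have j: "j < m" "i j < N" using indices_less[OF i] by auto
          show "cmod (y j (i j)) \<le> 1" by (rule y1[OF j])
          show "cmod (y' j (i j)) \<le> 1" by (rule order_trans[OF y'(1)[OF j] y1[OF j]])
        qed
        also have "\<dots> \<le> (\<Sum>j<m. 2 / L)"
          using indices_less[OF i] by (intro sum_mono y'(2)) auto
        finally show "cmod (complex_of_real (e i) * ((\<Prod>j<m. y j (i j)) - (\<Prod>j<m. y' j (i j)))) \<le> m * (2 / L)"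
          using e1[OF i] by (simp add: norm_mult)
      qed
      also have "\<dots> = 2 * m"
        using N by (simp add: indices_def card_PiE L_def)
      finally show ?thesis .
    qed
    ultimately show ?thesis
      using norm_triangle_ineq[of "T y'" "T y - T y'"] by simp
  qed
  then show ?thesis using e unfolding T_def by blast
qed

text \<open>
  Young's inequality for \<open>N * u n\<close> and \<open>1\<close>, with the weights \<open>2 * a\<close> and \<open>1 - 2 * a\<close>, summed over \<open>n\<close>.
\<close>

lemma sum_squares_le:
  assumes u: "weights N u" and a: "0 \<le> a" "a \<le> 1 / 2"
    and x: "\<And>n. n < N \<Longrightarrow> cmod (x n) \<le> wpow (u n) a" and N: "1 \<le> N"
  shows "(\<Sum>n<N. (cmod (x n))\<^sup>2) \<le> real N powr (1 - 2 * a)"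
proof -
  have "(\<Sum>n<N. (cmod (x n))\<^sup>2) \<le> (\<Sum>n<N. real N powr (- (2 * a)) * (2 * a * (real N * u n) + (1 - 2 * a)))"
  proof (intro sum_mono)
    fix n assume "n \<in> {..<N}"
    then have n: "n < N" by simp
    have u0: "0 \<le> u n" using u n by (rule weights_nonneg)
    have "(cmod (x n))\<^sup>2 \<le> (wpow (u n) a)\<^sup>2"
      using x[OF n] by (intro power_mono) auto
    also have "\<dots> = real N powr (- (2 * a)) * wpow (real N * u n) (2 * a)"
      using N u0 by (simp add: wpow_power2 wpow_mult_left wpow_pos powr_minus)
    also have "wpow (real N * u n) (2 * a) \<le> 2 * a * (real N * u n) + (1 - 2 * a)"
    proof (cases "a = 0")
      case False
      then show ?thesis
        using Young_nonneg[of "2 * a" "1 - 2 * a" "real N * u n" 1] a u0 by (simp add: wpow_def)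
    qed (simp add: wpow_def)
    finally show "(cmod (x n))\<^sup>2 \<le> real N powr (- (2 * a)) * (2 * a * (real N * u n) + (1 - 2 * a))"
      by (simp add: mult_left_mono)
  qed
  also have "\<dots> = real N powr (- (2 * a)) * (2 * a * real N * (\<Sum>n<N. u n) + real N * (1 - 2 * a))"
    by (simp add: sum.distrib mult.assoc flip: sum_distrib_left)
  also have "\<dots> \<le> real N powr (- (2 * a)) * (2 * a * real N * 1 + real N * (1 - 2 * a))"
    using u a by (intro mult_left_mono add_right_mono) (auto simp: weights_def)
  also have "\<dots> = real N powr (- (2 * a)) * real N powr 1"
    using N by (simp add: algebra_simps)
  also have "\<dots> = real N powr (1 - 2 * a)"
    unfolding powr_add[symmetric] by simp
  finally show ?thesis .
qed

text \<open>
  For exponents at least \<open>2\<close> the unit balls of the \<open>N\<close>-dimensional spaces lie in Euclidean balls of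
  radius \<open>N powr (1 / 2 - \<alpha> j)\<close>, so a bound on Euclidean balls suffices.
\<close>

lemma form_bound_of_euclidean_bound:
  assumes N: "1 \<le> N" and al: "\<And>j. j < m \<Longrightarrow> 0 \<le> \<alpha> j" "\<And>j. j < m \<Longrightarrow> \<alpha> j \<le> 1 / 2"
    and eb: "\<And>y. (\<And>j. j < m \<Longrightarrow> (\<Sum>n<N. (cmod (y j n))\<^sup>2) \<le> 1) \<Longrightarrow>
      cmod (\<Sum>i\<in>indices m N. a i * (\<Prod>j<m. y j (i j))) \<le> B"
  shows "form_bound m N \<alpha> a (real N powr (m / 2 - (\<Sum>j<m. \<alpha> j)) * B)"
  unfolding form_bound_def
proof (intro allI impI)
  fix u and x :: "nat \<Rightarrow> nat \<Rightarrow> complex"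
  assume u: "\<forall>j<m. weights N (u j)" and x: "\<forall>j<m. \<forall>n<N. cmod (x j n) \<le> wpow (u j n) (\<alpha> j)"
  define \<rho> where "\<rho> j = real N powr (1 / 2 - \<alpha> j)" for j
  have rho: "\<rho> j > 0" for j using N by (simp add: \<rho>_def)
  have rho2: "(\<rho> j)\<^sup>2 = real N powr (1 - 2 * \<alpha> j)" for j
    by (simp add: \<rho>_def power2_eq_square algebra_simps flip: powr_add)
  define y where "y j n = x j n / \<rho> j" for j n
  have y: "(\<Sum>n<N. (cmod (y j n))\<^sup>2) \<le> 1" if j: "j < m" for j
  proof -
    have "(\<Sum>n<N. (cmod (y j n))\<^sup>2) = (\<Sum>n<N. (cmod (x j n))\<^sup>2) / (\<rho> j)\<^sup>2"
      by (simp add: y_def norm_divide power_divide sum_divide_distrib)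
    also have "\<dots> \<le> (\<rho> j)\<^sup>2 / (\<rho> j)\<^sup>2"
      using u x al j N unfolding rho2
      by (intro divide_right_mono sum_squares_le[where u = "u j"]) auto
    finally show ?thesis using rho[of j] by simp
  qed
  have prod_rho: "(\<Prod>j<m. \<rho> j) = real N powr (m / 2 - (\<Sum>j<m. \<alpha> j))"
  proof -
    have "(\<Sum>j<m. 1 / 2 - \<alpha> j) = m / 2 - (\<Sum>j<m. \<alpha> j)" by (simp add: sum_subtractf)
    then show ?thesis using N unfolding \<rho>_def by (metis powr_sum of_nat_0_eq_iff not_one_le_zero)
  qed
  have "x j n = \<rho> j * y j n" for j n
    using rho[of j] by (simp add: y_def)
  then have "(\<Sum>i\<in>indices m N. a i * (\<Prod>j<m. x j (i j)))
      = (\<Prod>j<m. complex_of_real (\<rho> j)) * (\<Sum>i\<in>indices m N. a i * (\<Prod>j<m. y j (i j)))"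
    by (simp add: prod.distrib sum_distrib_left mult_ac)
  also have "cmod \<dots> = (\<Prod>j<m. \<rho> j) * cmod (\<Sum>i\<in>indices m N. a i * (\<Prod>j<m. y j (i j)))"
    using rho by (simp add: norm_mult prod_norm[symmetric] less_imp_le)
  also have "\<dots> \<le> (\<Prod>j<m. \<rho> j) * B"
    using rho by (intro mult_left_mono eb y prod_nonneg) (auto simp: less_imp_le)
  finally show "cmod (\<Sum>i\<in>indices m N. a i * (\<Prod>j<m. x j (i j))) \<le> real N powr (m / 2 - (\<Sum>j<m. \<alpha> j)) * B"
    by (simp add: prod_rho)
qed

text \<open>
  On Euclidean unit balls random signs give norm at most \<open>\<surd>N\<close> up to a logarithm. The radii of the
  Euclidean balls contribute \<open>N powr (m / 2 - (\<Sum>j<m. \<alpha> j))\<close>.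
\<close>

lemma random_form_bound:
  assumes m: "1 \<le> m" and al: "\<And>j. j < m \<Longrightarrow> 0 \<le> \<alpha> j" "\<And>j. j < m \<Longrightarrow> \<alpha> j \<le> 1 / 2"
  shows "\<exists>K>0. \<forall>N\<ge>1. \<exists>a. (\<forall>i\<in>indices m N. cmod (a i) = 1) \<and>
       form_bound m N \<alpha> a (K * (1 + ln (real N)) * real N powr ((real m + 1) / 2 - (\<Sum>j<m. \<alpha> j)))"
proof -
  define K where "K = 2 * ln 4 + 4 * m * ln 3 + 4 * (real m)\<^sup>2 + 1 + 2 * m"
  have "ln 4 \<ge> (0::real)" "ln 3 \<ge> (0::real)" by auto
  then have K: "0 < K" by (auto simp: K_def intro!: add_nonneg_pos add_pos_nonneg)
  have "\<exists>a. (\<forall>i\<in>indices m N. cmod (a i) = 1) \<and>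
       form_bound m N \<alpha> a (K * (1 + ln (real N)) * real N powr ((real m + 1) / 2 - (\<Sum>j<m. \<alpha> j)))"
    if N: "1 \<le> N" for N :: nat
  proof -
    have lnN: "ln N \<ge> 0" and sN: "sqrt N \<ge> 1" using N by auto
    define R where "R = ln (4 * real (2 * N ^ m + 1) ^ (2 * N * m)) / sqrt N + sqrt N / 2"
    obtain e where e: "e \<in> PiE (indices m N) (\<lambda>_. {-1, 1 :: real})"
      and bd: "\<And>y. \<forall>j<m. (\<Sum>n<N. (cmod (y j n))\<^sup>2) \<le> 1 \<Longrightarrow>
        cmod (\<Sum>i\<in>indices m N. complex_of_real (e i) * (\<Prod>j<m. y j (i j))) \<le> 2 * R + 2 * m"
      using random_form[OF m N] unfolding R_def by blast
    have "ln (real (2 * N ^ m + 1)) \<le> ln (3 * real N ^ m)"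
      using N by (intro ln_mono) (auto simp: one_le_power intro: add_pos_nonneg)
    also have "\<dots> = ln 3 + m * ln N"
      using N by (simp add: ln_mult ln_realpow)
    finally have l: "ln (real (2 * N ^ m + 1)) \<le> ln 3 + m * ln N" .
    have "ln (4 * real (2 * N ^ m + 1) ^ (2 * N * m)) = ln 4 + 2 * N * m * ln (real (2 * N ^ m + 1))"
      by (subst ln_mult) (auto simp: ln_realpow simp del: of_nat_add of_nat_mult of_nat_power)
    also have "\<dots> \<le> N * ln 4 + 2 * N * m * (ln 3 + m * ln N)"
      using N l by (intro add_mono mult_left_mono) (auto simp: mult_le_cancel_right1)
    finally have "ln (4 * real (2 * N ^ m + 1) ^ (2 * N * m)) / sqrt N
        \<le> (N * ln 4 + 2 * N * m * (ln 3 + m * ln N)) / sqrt N"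
      by (intro divide_right_mono) auto
    also have "\<dots> = (N / sqrt N) * (ln 4 + 2 * m * (ln 3 + m * ln N))"
      by (simp add: add_divide_distrib algebra_simps)
    also have "N / sqrt N = sqrt N"
      by (simp add: real_div_sqrt)
    finally have R_le: "R \<le> sqrt N * (ln 4 + 2 * m * (ln 3 + m * ln N)) + sqrt N / 2"
      unfolding R_def by (rule add_right_mono)
    have m_le: "1 * real (2 * m) \<le> sqrt N * real (2 * m)"
      using sN by (intro mult_right_mono) auto
    have "2 * R + 2 * m \<le> 2 * (sqrt N * (ln 4 + 2 * m * (ln 3 + m * ln N)) + sqrt N / 2) + sqrt N * (2 * m)"
      by (rule order_trans[OF _ add_mono[OF mult_left_mono[OF R_le, of 2] m_le]]) auto
    also have "\<dots> = sqrt N * (2 * ln 4 + 4 * m * ln 3 + 4 * (real m)\<^sup>2 * ln N + 1 + 2 * m)"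
      by (simp add: algebra_simps power2_eq_square)
    also have "\<dots> \<le> sqrt N * (K * (1 + ln N))"
    proof (rule mult_left_mono)
      have "0 \<le> (2 * ln 4 + 4 * m * ln 3 + 1 + 2 * m) * ln N + 4 * (real m)\<^sup>2"
        using lnN \<open>ln 4 \<ge> 0\<close> \<open>ln 3 \<ge> 0\<close> by (intro mult_nonneg_nonneg add_nonneg_nonneg) auto
      then show "2 * ln 4 + 4 * m * ln 3 + 4 * (real m)\<^sup>2 * ln N + 1 + 2 * m \<le> K * (1 + ln N)"
        by (simp add: K_def algebra_simps)
    qed simp
    finally have bound: "2 * R + 2 * m \<le> sqrt N * (K * (1 + ln N))" .
    have "form_bound m N \<alpha> (\<lambda>i. complex_of_real (e i)) (real N powr (m / 2 - (\<Sum>j<m. \<alpha> j)) * (sqrt N * (K * (1 + ln N))))"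
      using bd by (intro form_bound_of_euclidean_bound[OF N al] order_trans[OF bd bound]) auto
    moreover have "real N powr (m / 2 - (\<Sum>j<m. \<alpha> j)) * (sqrt N * (K * (1 + ln N)))
        = K * (1 + ln N) * real N powr ((real m + 1) / 2 - (\<Sum>j<m. \<alpha> j))"
    proof -
      have "(real m + 1) / 2 - (\<Sum>j<m. \<alpha> j) = (m / 2 - (\<Sum>j<m. \<alpha> j)) + 1 / 2" by (simp add: field_simps)
      then have "real N powr ((real m + 1) / 2 - (\<Sum>j<m. \<alpha> j)) = real N powr (m / 2 - (\<Sum>j<m. \<alpha> j)) * sqrt N"
        by (simp only: powr_add powr_half_sqrt of_nat_0_le_iff)
      then show ?thesis by simp
    qed
    moreover have "\<forall>i\<in>indices m N. cmod (complex_of_real (e i)) = 1"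
      using e by (auto dest!: PiE_mem)
    ultimately show ?thesis
      by (intro exI[of _ "\<lambda>i. complex_of_real (e i)"]) simp
  qed
  then show ?thesis using K by blast
qed

section \<open>The optimal exponents\<close>

text \<open>
  A logarithm does not affect the comparison of exponents, as \<open>ln N\<close> is at most a multiple of every
  positive power of \<open>N\<close>.
\<close>

lemma growth_exponent_le:
  fixes x y K :: real
  assumes K: "0 < K" and le: "\<And>N. 1 \<le> N \<Longrightarrow> real N powr x \<le> K * (1 + ln N) * real N powr y"
  shows "x \<le> y"
proof (rule ccontr)
  assume "\<not> x \<le> y"
  define \<delta> where "\<delta> = x - y"
  have del: "\<delta> > 0" using \<open>\<not> x \<le> y\<close> by (simp add: \<delta>_def)
  have bound: "real N powr (\<delta> / 2) \<le> K * (1 + 2 / \<delta>)" if N: "1 \<le> N" for N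
  proof -
    have "ln N \<le> real N powr (\<delta> / 2) / (\<delta> / 2)"
      using N del by (intro ln_powr_bound) auto
    moreover have "1 \<le> real N powr (\<delta> / 2)"
      using N del by (intro ge_one_powr_ge_zero) auto
    ultimately have 1: "1 + ln N \<le> (1 + 2 / \<delta>) * real N powr (\<delta> / 2)"
      by (simp add: algebra_simps)
    have "real N powr (\<delta> / 2) * (real N powr (\<delta> / 2) * real N powr y) = real N powr x"
      by (simp add: \<delta>_def field_simps flip: powr_add)
    also have "\<dots> \<le> K * (1 + ln N) * real N powr y" by (rule le[OF N])
    also have "\<dots> \<le> K * ((1 + 2 / \<delta>) * real N powr (\<delta> / 2)) * real N powr y"
      using K 1 by (intro mult_right_mono mult_left_mono) auto
    also have "\<dots> = K * (1 + 2 / \<delta>) * (real N powr (\<delta> / 2) * real N powr y)" by simp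
    finally show ?thesis
      by (rule mult_right_le_imp_le) (use N in auto)
  qed
  define B where "B = K * (1 + 2 / \<delta>)"
  have B: "B > 0" using K del by (auto simp: B_def intro!: mult_pos_pos add_pos_pos)
  obtain N :: nat where N: "(B + 1) powr (2 / \<delta>) < real N" using reals_Archimedean2 by blast
  moreover have "1 \<le> (B + 1) powr (2 / \<delta>)"
    using B del by (intro ge_one_powr_ge_zero) auto
  ultimately have "1 \<le> N" by simp
  have "B + 1 = ((B + 1) powr (2 / \<delta>)) powr (\<delta> / 2)"
    using B del by (simp add: powr_powr)
  also have "\<dots> \<le> real N powr (\<delta> / 2)"
    using N del by (intro powr_mono2) auto
  also have "\<dots> \<le> B" using bound[OF \<open>1 \<le> N\<close>] by (simp add: B_def)
  finally show False by simp
qed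

theorem proposition4p1:
  fixes m :: nat and p :: "nat \<Rightarrow> ennreal" and lam mu :: real
  assumes "m \<ge> 1"
    and "\<And>j. j < m \<Longrightarrow> 1 \<le> p j"
    and "(\<Sum>j<m. enn2real (1 / p j)) < 1"
    and "1 / lam = 1 - (\<Sum>j<m. enn2real (1 / p j))"
    and "1 / mu = 1 / (real m * lam) + (real m - 1) / (2 * real m)"
  shows "(\<exists>C>0. (1 / 2 \<le> (\<Sum>j<m. enn2real (1 / p j)) \<longrightarrow> coeff_bound m p lam C) \<and>
                ((\<Sum>j<m. enn2real (1 / p j)) < 1 / 2 \<longrightarrow> coeff_bound m p mu C)) \<and>
         (1 / 2 \<le> (\<Sum>j<m. enn2real (1 / p j)) \<longrightarrow>
            (\<forall>t>0. (\<exists>C>0. coeff_bound m p t C) \<longrightarrow> lam \<le> t)) \<and>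
         ((\<Sum>j<m. enn2real (1 / p j)) < 1 / 2 \<longrightarrow>
            (\<forall>t>0. (\<exists>C>0. coeff_bound m p t C) \<longrightarrow> mu \<le> t))"
proof -
  define \<alpha> where "\<alpha> = (\<lambda>j. enn2real (1 / p j))"
  define S where "S = (\<Sum>j<m. enn2real (1 / p j))"
  note m = assms(1) and p = assms(2)
  have S: "(\<Sum>j<m. \<alpha> j) = S" by (simp add: S_def \<alpha>_def)
  have S1: "S < 1" and lam: "1 / lam = 1 - S"
    using assms(3,4) by (simp_all add: S_def)
  have al: "0 \<le> \<alpha> j" for j by (simp add: \<alpha>_def)
  have m0: "real m > 0" using m by simp
  have lam0: "lam > 0"
    using lam S1 by (metis diff_gt_0_iff_gt zero_less_divide_1_iff)
  have mu_eq: "m / mu = (real m + 1) / 2 - S"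
  proof -
    have "m / mu = m * (1 / mu)" by simp
    also have "\<dots> = 1 / lam + (real m - 1) / 2"
      unfolding assms(5) using m0 lam0 by (simp add: field_simps)
    finally show ?thesis unfolding lam by (simp add: field_simps)
  qed
  have mu0: "mu > 0"
  proof -
    have "0 < m / mu" using S1 m unfolding mu_eq by simp
    then show ?thesis using m0 by (simp add: zero_less_divide_iff)
  qed
  have upper_lam: "coeff_bound m p lam (sqrt 3 ^ m * 2 ^ m)" if "1 / 2 \<le> S"
  proof (rule coeff_bound_if_form_bounds)
    fix N a and M :: real
    assume "form_bound m N (\<lambda>j. enn2real (1 / p j)) a M" "0 < M"
    then show "(\<Sum>i\<in>indices m N. cmod (a i) powr lam) \<le> (sqrt 3 ^ m * M) powr lam"
      using that S1 S lam al by (intro coefficients_large_sum[where \<alpha> = \<alpha>]) (auto simp: \<alpha>_def)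
  qed (use p lam0 in auto)
  have upper_mu: "coeff_bound m p mu (sqrt 3 ^ m * 2 ^ m)" if "S < 1 / 2"
  proof (rule coeff_bound_if_form_bounds)
    fix N a and M :: real
    assume "form_bound m N (\<lambda>j. enn2real (1 / p j)) a M" "0 < M"
    then show "(\<Sum>i\<in>indices m N. cmod (a i) powr mu) \<le> (sqrt 3 ^ m * M) powr mu"
      using that S lam al m assms(5)
      by (intro coefficients_small_sum[where \<alpha> = \<alpha> and lam = lam]) (auto simp: \<alpha>_def)
  qed (use p mu0 in auto)
  have lower_lam: "lam \<le> t" if t: "0 < t" and C: "0 < C" and cb: "coeff_bound m p t C" for t C
  proof -
    have "1 / t \<le> 1 - S"
    proof (rule growth_exponent_le[OF C])
      fix N :: nat assume N: "1 \<le> N"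
      have "form_bound m N \<alpha> (diagonal_coeff m N) (real N powr (1 - S))"
        using form_bound_diagonal[OF m N, of \<alpha>] al S1 S by simp
      then have "(\<Sum>i\<in>indices m N. cmod (diagonal_coeff m N i) powr t) powr (1 / t) \<le> C * real N powr (1 - S)"
        unfolding \<alpha>_def by (rule coeff_bound_finite_form[rotated 4]) (use p t C cb in auto)
      also have "\<dots> \<le> C * (1 + ln N) * real N powr (1 - S)"
        using N C by (intro mult_right_mono) auto
      finally show "real N powr (1 / t) \<le> C * (1 + ln N) * real N powr (1 - S)"
        by (simp add: sum_diagonal_coeff[OF m t])
    qed
    then show ?thesis
      unfolding lam[symmetric] using t lam0 by (simp add: field_simps)
  qed
  have lower_mu: "mu \<le> t" if half: "S < 1 / 2" and t: "0 < t" and C: "0 < C" and cb: "coeff_bound m p t C" for t C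
  proof -
    have al2: "\<alpha> j \<le> 1 / 2" if "j < m" for j
    proof -
      have "\<alpha> j \<le> (\<Sum>j<m. \<alpha> j)" using that al by (intro member_le_sum) auto
      then show ?thesis using half S by simp
    qed
    obtain K where K: "0 < K" and forms: "\<And>N. 1 \<le> N \<Longrightarrow> \<exists>a. (\<forall>i\<in>indices m N. cmod (a i) = 1) \<and>
        form_bound m N \<alpha> a (K * (1 + ln (real N)) * real N powr ((real m + 1) / 2 - (\<Sum>j<m. \<alpha> j)))"
      using random_form_bound[OF m, of \<alpha>] al al2 by blast
    have "m / t \<le> (real m + 1) / 2 - S"
    proof (rule growth_exponent_le)
      show "0 < C * K" using C K by simp
      fix N :: nat assume N: "1 \<le> N"
      obtain a where a: "\<And>i. i \<in> indices m N \<Longrightarrow> cmod (a i) = 1"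
        and bd: "form_bound m N \<alpha> a (K * (1 + ln N) * real N powr ((real m + 1) / 2 - S))"
        using forms[OF N] S by auto
      have "(\<Sum>i\<in>indices m N. cmod (a i) powr t) = real N ^ m"
        using a by (simp add: indices_def card_PiE)
      then have "real N powr (m / t) = (\<Sum>i\<in>indices m N. cmod (a i) powr t) powr (1 / t)"
        using N by (simp add: powr_powr flip: powr_realpow)
      also have "\<dots> \<le> C * (K * (1 + ln N) * real N powr ((real m + 1) / 2 - S))"
        using bd unfolding \<alpha>_def by (rule coeff_bound_finite_form[rotated 4]) (use p t C cb in auto)
      finally show "real N powr (m / t) \<le> C * K * (1 + ln N) * real N powr ((real m + 1) / 2 - S)"
        by (simp add: mult.assoc)
    qed
    then show ?thesis
      unfolding mu_eq[symmetric] using t mu0 m0 by (simp add: field_simps)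
  qed
  show ?thesis
    unfolding S_def[symmetric]
  proof (intro conjI impI allI)
    show "\<exists>C>0. (1 / 2 \<le> S \<longrightarrow> coeff_bound m p lam C) \<and> (S < 1 / 2 \<longrightarrow> coeff_bound m p mu C)"
      using upper_lam upper_mu by (intro exI[of _ "sqrt 3 ^ m * 2 ^ m"]) auto
  qed (use lower_lam lower_mu in blast)+
qed

end
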